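(* Let $R$ be an LG-ring, let $M$ be a finite locally free $R$-module, and let $U \subset \mathbf{W}(M)$ be an open quasi-compact subscheme. (a) $U(R) \neq \emptyset$ if and only if $U(R/\mathfrak{m}) \neq \emptyset$ for every maximal ideal $\mathfrak{m}$ of $R$. (b) If $R$ satisfies the primitive criterion and $U$ is $R$-dense in $\mathbf{W}(M)$, then $U(R) \neq \emptyset$.
   Context: All rings are commutative and unital. A polynomial $f \in R[X_1,\dots,X_n]$ represents a unit over an $R$-algebra $S$ if there are $s_1,\dots,s_n\in S$ with $f(s_1,\dots,s_n)\in S^\times$. A ring $R$ is an LG-ring if for every $n$ and every $f\in R[X_1,\dots,X_n]$: $f$ represents a unit over $R$ if and only if $f$ represents a unit over $R/\mathfrak{m}$ for every maximal ideal $\mathfrak{m}$ of $R$. A polynomial over $R$ is primitive if its coefficients generate $R$ as an ideal. $R$ satisfies the primitive criterion if for every primitive $P\in R[X]$ there is $r\in R$ with $P(r)\in R^\times$; equivalently, $R$ is an LG-ring all of whose residue fields are infinite. A finite locally free $R$-module is the same as a finitely generated projective $R$-module. For such $M$, $\mathbf{W}(M)$ is the affine $R$-scheme representing the functor $T\mapsto M\otimes_R T$ on commutative $R$-algebras $T$. An open subscheme $U$ of $\mathbf{W}(M)$ is $R$-dense if for every $s\in\mathrm{Spec}(R)$ the fibre $U_s$ is (schematically) dense in the fibre $\mathbf{W}(M)_s$. *)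

theory Defs
  imports
    "HOL-Analysis.Function_Topology"
    "HOL-Algebra.QuotRing"
    "HOL-Algebra.Module"
    "HOL-Algebra.UnivPoly"
    "HOL-Algebra.Indexed_Polynomials"
begin

text \<open>An algebra over \<open>R\<close> is given by a commutative ring \<open>S\<close> together with a structure map
  \<open>\<rho> \<in> ring_hom R S\<close>. The algebra \<open>R/\<mm>\<close> is \<open>R Quot \<mm>\<close> with structure map \<open>(+>\<^bsub>R\<^esub>) \<mm>\<close>.\<close>

section \<open>Multivariate polynomials and LG-rings\<close>

text \<open>The ring \<open>R[X\<^sub>i | i \<in> I]\<close>. As in \<^theory>\<open>HOL-Algebra.Indexed_Polynomials\<close>, monomials
  are multisets of indices, and a polynomial maps a monomial to its coefficient.\<close>

definition mpoly_ring :: "('a, 'm) ring_scheme \<Rightarrow> 'i set \<Rightarrow> ('i multiset \<Rightarrow> 'a) ring" where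
  "mpoly_ring R I = \<lparr>
     carrier = {P. (\<forall>m. P m \<in> carrier R) \<and> finite {m. P m \<noteq> \<zero>\<^bsub>R\<^esub>} \<and>
                   (\<forall>m. P m \<noteq> \<zero>\<^bsub>R\<^esub> \<longrightarrow> set_mset m \<subseteq> I)},
     monoid.mult = (\<lambda>P Q m. \<Oplus>\<^bsub>R\<^esub>a\<in>{a. a \<subseteq># m}. P a \<otimes>\<^bsub>R\<^esub> Q (m - a)),
     one = ring.indexed_const R \<one>\<^bsub>R\<^esub>,
     zero = ring.indexed_const R \<zero>\<^bsub>R\<^esub>,
     add = ring.indexed_padd R\<rparr>"

lemma mpoly_ring_ops:
  assumes "ring R"
  shows "one (mpoly_ring R I) = (\<lambda>m. if m = {#} then \<one>\<^bsub>R\<^esub> else \<zero>\<^bsub>R\<^esub>)"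
    and "zero (mpoly_ring R I) = (\<lambda>m. \<zero>\<^bsub>R\<^esub>)"
    and "add (mpoly_ring R I) = (\<lambda>P Q m. P m \<oplus>\<^bsub>R\<^esub> Q m)"
    and "monoid.mult (mpoly_ring R I) = (\<lambda>P Q m. \<Oplus>\<^bsub>R\<^esub>a\<in>{a. a \<subseteq># m}. P a \<otimes>\<^bsub>R\<^esub> Q (m - a))"
  using assms
  by (auto simp: mpoly_ring_def ring.indexed_const_def ring.indexed_padd_def fun_eq_iff)

context cring
begin

lemma finsum_swap:
  assumes "finite A" "finite B" "\<And>a b. a \<in> A \<Longrightarrow> b \<in> B \<Longrightarrow> f a b \<in> carrier R"
  shows "(\<Oplus>a\<in>A. \<Oplus>b\<in>B. f a b) = (\<Oplus>b\<in>B. \<Oplus>a\<in>A. f a b)"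
  using assms(1,3)
proof (induction A rule: finite_induct)
  case empty
  then show ?case by simp
next
  case (insert x A)
  have "(\<Oplus>b\<in>B. \<Oplus>a\<in>insert x A. f a b) = (\<Oplus>b\<in>B. f x b \<oplus> (\<Oplus>a\<in>A. f a b))"
    using insert by (intro finsum_cong') (auto simp: Pi_iff intro!: finsum_closed)
  also have "\<dots> = (\<Oplus>b\<in>B. f x b) \<oplus> (\<Oplus>b\<in>B. \<Oplus>a\<in>A. f a b)"
    using insert by (intro finsum_addf) (auto intro!: finsum_closed)
  also have "\<dots> = (\<Oplus>b\<in>B. f x b) \<oplus> (\<Oplus>a\<in>A. \<Oplus>b\<in>B. f a b)"
    using insert by simp
  also have "\<dots> = (\<Oplus>a\<in>insert x A. \<Oplus>b\<in>B. f a b)"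
    using insert by (subst finsum_insert) (auto intro!: finsum_closed)
  finally show ?case by simp
qed

lemma finsum_swap_dep:
  assumes "finite A" "finite B" 
    "\<And>a b. a \<in> A \<Longrightarrow> b \<in> B \<Longrightarrow> Q a b \<Longrightarrow> f a b \<in> carrier R"
  shows "(\<Oplus>a\<in>A. \<Oplus>b\<in>{b\<in>B. Q a b}. f a b) = (\<Oplus>b\<in>B. \<Oplus>a\<in>{a\<in>A. Q a b}. f a b)"
proof -
  have "(\<Oplus>a\<in>A. \<Oplus>b\<in>{b\<in>B. Q a b}. f a b) = (\<Oplus>a\<in>A. \<Oplus>b\<in>B. if Q a b then f a b else \<zero>)"
    using assms by (intro finsum_cong' refl add.finprod_mono_neutral_cong_left) (auto intro!: finsum_closed)
  also have "\<dots> = (\<Oplus>b\<in>B. \<Oplus>a\<in>A. if Q a b then f a b else \<zero>)"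
    using assms by (intro finsum_swap) auto
  also have "\<dots> = (\<Oplus>b\<in>B. \<Oplus>a\<in>{a\<in>A. Q a b}. f a b)"
    using assms by (intro finsum_cong' refl add.finprod_mono_neutral_cong_right) (auto intro!: finsum_closed)
  finally show ?thesis .
qed

lemma finite_submsets: "finite {a. a \<subseteq># (m :: 'i multiset)}"
proof (induction m)
  case empty
  then show ?case by simp
next
  case (add x m)
  have "{a. a \<subseteq># add_mset x m} \<subseteq> {a. a \<subseteq># m} \<union> add_mset x ` {a. a \<subseteq># m}"
  proof
    fix a assume "a \<in> {a. a \<subseteq># add_mset x m}"
    then have a: "a \<subseteq># add_mset x m" by simp
    show "a \<in> {a. a \<subseteq># m} \<union> add_mset x ` {a. a \<subseteq># m}"
    proof (cases "x \<in># a")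
      case True
      then obtain b where "a = add_mset x b" by (meson mset_add)
      with a show ?thesis by auto
    next
      case False
      with a have "a \<subseteq># m" 
        by (metis diff_single_trivial insert_DiffM subset_eq_diff_conv add_mset_remove_trivial subset_mset.diff_add add_mset_add_single)
      then show ?thesis by simp
    qed
  qed
  with add show ?case by (meson finite_UnI finite_imageI finite_subset)
qed

abbreviation (input) mpoly_mult where "mpoly_mult P Q m \<equiv> (\<Oplus>a\<in>{a. a \<subseteq># m}. P a \<otimes> Q (m - a))"

lemma mpoly_mult_closed:
  assumes "\<And>m. P m \<in> carrier R" "\<And>m. Q m \<in> carrier R"
  shows "mpoly_mult P Q m \<in> carrier R"
  using assms by (auto intro!: finsum_closed)

lemma mpoly_mult_comm:
  fixes P :: "'i multiset \<Rightarrow> 'a"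
  assumes "\<And>m. P m \<in> carrier R" "\<And>m. Q m \<in> carrier R"
  shows "mpoly_mult P Q m = mpoly_mult Q P m"
proof -
  have i: "inj_on (\<lambda>a. m - a) {a. a \<subseteq># m}"
    by (auto simp: inj_on_def) (metis subset_mset.diff_diff_right add_diff_cancel_left' subset_mset.add_diff_inverse diff_diff_add_mset)
  have im: "(\<lambda>a. m - a) ` {a. a \<subseteq># m} = {a. a \<subseteq># m}"
    by (auto simp: image_iff) (metis diff_subset_eq_self subset_mset.diff_diff_right add_diff_cancel_left' subset_mset.add_diff_inverse)
  have "mpoly_mult Q P m = (\<Oplus>a\<in>(\<lambda>a. m - a) ` {a. a \<subseteq># m}. Q a \<otimes> P (m - a))"
    by (simp add: im)
  also have "\<dots> = (\<Oplus>a\<in>{a. a \<subseteq># m}. Q (m - a) \<otimes> P (m - (m - a)))"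
    using assms i by (intro finsum_reindex) auto
  also have "\<dots> = mpoly_mult P Q m"
    using assms by (intro finsum_cong' refl) (auto simp: m_comm subset_mset.diff_diff_right)
  finally show ?thesis by simp
qed

lemma mpoly_mult_assoc:
  fixes P :: "'i multiset \<Rightarrow> 'a"
  assumes [simp]: "\<And>m. P m \<in> carrier R" "\<And>m. Q m \<in> carrier R" "\<And>m. S m \<in> carrier R"
  shows "mpoly_mult (mpoly_mult P Q) S m = mpoly_mult P (mpoly_mult Q S) m"
proof -
  let ?D = "{a. a \<subseteq># m}"
  have "mpoly_mult (mpoly_mult P Q) S m = (\<Oplus>a\<in>?D. \<Oplus>b\<in>{b\<in>?D. b \<subseteq># a}. P b \<otimes> Q (a - b) \<otimes> S (m - a))"
  proof (intro finsum_cong' refl)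
    fix a assume a: "a \<in> ?D"
    then have "{b. b \<subseteq># a} = {b\<in>?D. b \<subseteq># a}" by auto
    then show "mpoly_mult P Q a \<otimes> S (m - a) = (\<Oplus>b\<in>{b\<in>?D. b \<subseteq># a}. P b \<otimes> Q (a - b) \<otimes> S (m - a))"
      using finite_submsets[of a] by (subst finsum_ldistr) auto
  qed (auto intro!: finsum_closed)
  also have "\<dots> = (\<Oplus>b\<in>?D. \<Oplus>a\<in>{a\<in>?D. b \<subseteq># a}. P b \<otimes> Q (a - b) \<otimes> S (m - a))"
    by (intro finsum_swap_dep finite_submsets) auto
  also have "\<dots> = mpoly_mult P (mpoly_mult Q S) m"
  proof (intro finsum_cong' refl)
    fix b assume b: "b \<in> ?D"
    have e: "{a\<in>?D. b \<subseteq># a} = (\<lambda>c. b + c) ` {c. c \<subseteq># m - b}"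
    proof -
      have "a \<in> (\<lambda>c. b + c) ` {c. c \<subseteq># m - b}" if "a \<subseteq># m" "b \<subseteq># a" for a
        using that b by (intro image_eqI[of _ _ "a - b"]) (auto simp: subset_mset.diff_add_assoc2 subseteq_mset_def le_diff_conv)
      moreover have "b + c \<subseteq># m" if "c \<subseteq># m - b" for c
        using that b subset_mset.le_diff_conv2[of b m c] by (simp add: add.commute)
      ultimately show ?thesis by auto
    qed
    have "(\<Oplus>a\<in>{a\<in>?D. b \<subseteq># a}. P b \<otimes> Q (a - b) \<otimes> S (m - a)) =
          (\<Oplus>c\<in>{c. c \<subseteq># m - b}. P b \<otimes> Q (b + c - b) \<otimes> S (m - (b + c)))"
      unfolding e by (intro finsum_reindex) auto
    also have "\<dots> = (\<Oplus>c\<in>{c. c \<subseteq># m - b}. P b \<otimes> (Q c \<otimes> S (m - b - c)))"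
      by (intro finsum_cong' refl) (auto simp: m_assoc)
    also have "\<dots> = P b \<otimes> mpoly_mult Q S (m - b)"
      by (subst finsum_rdistr) (auto simp: finite_submsets)
    finally show "(\<Oplus>a\<in>{a\<in>?D. b \<subseteq># a}. P b \<otimes> Q (a - b) \<otimes> S (m - a)) = P b \<otimes> mpoly_mult Q S (m - b)" .
  qed (auto intro!: finsum_closed)
  finally show ?thesis .
qed

lemma mpoly_mult_one:
  fixes P :: "'i multiset \<Rightarrow> 'a"
  assumes [simp]: "\<And>m. P m \<in> carrier R"
  shows "mpoly_mult (\<lambda>m. if m = {#} then \<one> else \<zero>) P m = P m"
proof -
  have "mpoly_mult (\<lambda>m. if m = {#} then \<one> else \<zero>) P m = (\<Oplus>a\<in>{a. a \<subseteq># m}. if a = {#} then P m else \<zero>)"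
    by (intro finsum_cong' refl) auto
  also have "\<dots> = P m"
    using add.finprod_singleton_swap[of "{#}" "{a. a \<subseteq># m}" "\<lambda>_. P m"] finite_submsets[of m] by auto
  finally show ?thesis .
qed

lemma mpoly_mult_distrib:
  fixes P :: "'i multiset \<Rightarrow> 'a"
  assumes [simp]: "\<And>m. P m \<in> carrier R" "\<And>m. Q m \<in> carrier R" "\<And>m. S m \<in> carrier R"
  shows "mpoly_mult (\<lambda>m. P m \<oplus> Q m) S m = mpoly_mult P S m \<oplus> mpoly_mult Q S m"
  by (subst finsum_addf[symmetric]) (auto simp: l_distr intro!: finsum_cong')

lemma mpoly_mult_supp:
  fixes P :: "'i multiset \<Rightarrow> 'a"
  assumes [simp]: "\<And>m. P m \<in> carrier R" "\<And>m. Q m \<in> carrier R"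
  shows "{m. mpoly_mult P Q m \<noteq> \<zero>} \<subseteq> (\<lambda>(a, b). a + b) ` ({m. P m \<noteq> \<zero>} \<times> {m. Q m \<noteq> \<zero>})"
proof
  fix m assume "m \<in> {m. mpoly_mult P Q m \<noteq> \<zero>}"
  then obtain a where "a \<subseteq># m" "P a \<otimes> Q (m - a) \<noteq> \<zero>"
    using add.finprod_one_eqI[of "{a. a \<subseteq># m}" "\<lambda>a. P a \<otimes> Q (m - a)"] by auto
  then show "m \<in> (\<lambda>(a, b). a + b) ` ({m. P m \<noteq> \<zero>} \<times> {m. Q m \<noteq> \<zero>})"
    by (intro image_eqI[of _ _ "(a, m - a)"]) auto
qed

lemma cring_mpoly_ring: "cring (mpoly_ring R (I :: 'i set))"
proof -
  note s = mpoly_ring_ops[OF ring_axioms, of I]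
  have c: "carrier (mpoly_ring R I) = {P. (\<forall>m. P m \<in> carrier R) \<and> finite {m. P m \<noteq> \<zero>} \<and>
                   (\<forall>m. P m \<noteq> \<zero> \<longrightarrow> set_mset m \<subseteq> I)}" by (simp add: mpoly_ring_def)
  have fin: "finite {m. mpoly_mult P Q m \<noteq> \<zero>}" "mpoly_mult P Q m \<noteq> \<zero> \<Longrightarrow> set_mset m \<subseteq> I"
    if "P \<in> carrier (mpoly_ring R I)" "Q \<in> carrier (mpoly_ring R I)" for P Q m
  proof -
    have sub: "{m. mpoly_mult P Q m \<noteq> \<zero>} \<subseteq> (\<lambda>(a, b). a + b) ` ({m. P m \<noteq> \<zero>} \<times> {m. Q m \<noteq> \<zero>})"
      using that by (intro mpoly_mult_supp) (auto simp: c)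
    show "finite {m. mpoly_mult P Q m \<noteq> \<zero>}"
      using that by (intro finite_subset[OF sub]) (auto simp: c)
    assume "mpoly_mult P Q m \<noteq> \<zero>"
    then have "m \<in> (\<lambda>(a, b). a + b) ` ({m. P m \<noteq> \<zero>} \<times> {m. Q m \<noteq> \<zero>})"
      using sub by blast
    then obtain a b where ab: "m = a + b" "P a \<noteq> \<zero>" "Q b \<noteq> \<zero>" by auto
    then have "set_mset a \<subseteq> I" "set_mset b \<subseteq> I" using that unfolding c by blast+
    with ab show "set_mset m \<subseteq> I" by simp
  qed
  have fa: "finite {m. P m \<oplus> Q m \<noteq> \<zero>}"
    if "P \<in> carrier (mpoly_ring R I)" "Q \<in> carrier (mpoly_ring R I)" for P Q
    by (rule finite_subset[of _ "{m. P m \<noteq> \<zero>} \<union> {m. Q m \<noteq> \<zero>}"]) (use that in \<open>auto simp: c\<close>)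

  let ?P = "mpoly_ring R I"
  have C: "P m \<in> carrier R" if "P \<in> carrier ?P" for P m using that by (simp add: c)
  have add: "P \<oplus>\<^bsub>?P\<^esub> Q \<in> carrier ?P" if "P \<in> carrier ?P" "Q \<in> carrier ?P" for P Q
  proof -
    have "set_mset m \<subseteq> I" if "P m \<oplus> Q m \<noteq> \<zero>" for m
    proof -
      have "P m \<noteq> \<zero> \<or> Q m \<noteq> \<zero>" using that by auto
      then show ?thesis using \<open>P \<in> carrier ?P\<close> \<open>Q \<in> carrier ?P\<close> unfolding c by blast
    qed
    then show ?thesis using that fa[OF that] unfolding s(3) by (simp add: c)
  qed
  have mul: "P \<otimes>\<^bsub>?P\<^esub> Q \<in> carrier ?P" if "P \<in> carrier ?P" "Q \<in> carrier ?P" for P Q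
    unfolding s(4) c using fin[OF that] mpoly_mult_closed[of P Q] C[OF that(1)] C[OF that(2)] by blast
  have "abelian_group ?P"
  proof (rule abelian_groupI)
    fix x assume x: "x \<in> carrier ?P"
    have "(\<lambda>m. \<ominus> x m) \<in> carrier ?P"
      using x unfolding c by (auto; fastforce)
    moreover have "(\<lambda>m. \<ominus> x m) \<oplus>\<^bsub>?P\<^esub> x = \<zero>\<^bsub>?P\<^esub>"
      unfolding s by (rule ext) (simp add: C[OF x] l_neg)
    ultimately show "\<exists>y\<in>carrier ?P. y \<oplus>\<^bsub>?P\<^esub> x = \<zero>\<^bsub>?P\<^esub>" by blast
  next
    show "\<zero>\<^bsub>?P\<^esub> \<in> carrier ?P" unfolding s c by simp
  next
    fix x y assume "x \<in> carrier ?P" "y \<in> carrier ?P"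
    then show "x \<oplus>\<^bsub>?P\<^esub> y \<in> carrier ?P" by (rule add)
  qed (auto simp: s(2,3) C a_ac)
  moreover have "comm_monoid ?P"
  proof (rule comm_monoidI)
    show "\<one>\<^bsub>?P\<^esub> \<in> carrier ?P" unfolding s c by auto
  next
    fix x y z assume "x \<in> carrier ?P" "y \<in> carrier ?P" "z \<in> carrier ?P"
    then show "x \<otimes>\<^bsub>?P\<^esub> y \<otimes>\<^bsub>?P\<^esub> z = x \<otimes>\<^bsub>?P\<^esub> (y \<otimes>\<^bsub>?P\<^esub> z)"
      unfolding s by (intro ext mpoly_mult_assoc C)
  next
    fix x y assume "x \<in> carrier ?P" "y \<in> carrier ?P"
    then show "x \<otimes>\<^bsub>?P\<^esub> y = y \<otimes>\<^bsub>?P\<^esub> x"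
      unfolding s by (intro ext mpoly_mult_comm C)
  next
    fix x assume "x \<in> carrier ?P"
    then show "\<one>\<^bsub>?P\<^esub> \<otimes>\<^bsub>?P\<^esub> x = x"
      unfolding s by (intro ext mpoly_mult_one C)
  qed (rule mul)
  moreover have "(x \<oplus>\<^bsub>?P\<^esub> y) \<otimes>\<^bsub>?P\<^esub> z = x \<otimes>\<^bsub>?P\<^esub> z \<oplus>\<^bsub>?P\<^esub> y \<otimes>\<^bsub>?P\<^esub> z"
    if "x \<in> carrier ?P" "y \<in> carrier ?P" "z \<in> carrier ?P" for x y z
    using that unfolding s by (intro ext mpoly_mult_distrib C)
  ultimately show ?thesis by (intro cringI)
qed

end

definition mpoly_eval ::
  "('a, 'm) ring_scheme \<Rightarrow> ('s, 'k) ring_scheme \<Rightarrow> ('a \<Rightarrow> 's) \<Rightarrow> ('i \<Rightarrow> 's) \<Rightarrow> ('i multiset \<Rightarrow> 'a) \<Rightarrow> 's"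
where
  "mpoly_eval R S \<rho> s P =
     (\<Oplus>\<^bsub>S\<^esub>m\<in>{m. P m \<noteq> \<zero>\<^bsub>R\<^esub>}.
        \<rho> (P m) \<otimes>\<^bsub>S\<^esub> (\<Otimes>\<^bsub>S\<^esub>i\<in>set_mset m. s i [^]\<^bsub>S\<^esub> count m i))"

definition represents_unit ::
  "('a, 'm) ring_scheme \<Rightarrow> ('s, 'k) ring_scheme \<Rightarrow> ('a \<Rightarrow> 's) \<Rightarrow> 'i set \<Rightarrow> ('i multiset \<Rightarrow> 'a) \<Rightarrow> bool"
where
  "represents_unit R S \<rho> I P \<longleftrightarrow> (\<exists>s \<in> I \<rightarrow> carrier S. mpoly_eval R S \<rho> s P \<in> Units S)"

definition LG_ring :: "('a, 'm) ring_scheme \<Rightarrow> bool" where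
  "LG_ring R \<longleftrightarrow> cring R \<and>
     (\<forall>n::nat. \<forall>P \<in> carrier (mpoly_ring R {1..n}).
        represents_unit R R (\<lambda>r. r) {1..n} P \<longleftrightarrow>
        (\<forall>\<mm>. maximalideal \<mm> R \<longrightarrow>
           represents_unit R (R Quot \<mm>) (a_r_coset R \<mm>) {1..n} P))"

definition primitive_poly :: "('a, 'm) ring_scheme \<Rightarrow> (nat \<Rightarrow> 'a) \<Rightarrow> bool" where
  "primitive_poly R P \<longleftrightarrow> P \<in> carrier (UP R) \<and> Idl\<^bsub>R\<^esub> (range (up_ring.coeff (UP R) P)) = carrier R"

definition primitive_criterion :: "('a, 'm) ring_scheme \<Rightarrow> bool" where
  "primitive_criterion R \<longleftrightarrow>
     (\<forall>P. primitive_poly R P \<longrightarrow> (\<exists>r \<in> carrier R. UnivPoly.eval R R (\<lambda>x. x) r P \<in> Units R))"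

section \<open>Finitely generated projective modules\<close>

definition linear_maps ::
  "('a, 'm) ring_scheme \<Rightarrow> ('a, 'b, 'n) module_scheme \<Rightarrow> ('a, 'c, 'k) module_scheme \<Rightarrow> ('b \<Rightarrow> 'c) set"
where
  "linear_maps R M N = {f \<in> carrier M \<rightarrow> carrier N.
     (\<forall>x\<in>carrier M. \<forall>y\<in>carrier M. f (x \<oplus>\<^bsub>M\<^esub> y) = f x \<oplus>\<^bsub>N\<^esub> f y) \<and>
     (\<forall>r\<in>carrier R. \<forall>x\<in>carrier M. f (r \<odot>\<^bsub>M\<^esub> x) = r \<odot>\<^bsub>N\<^esub> f x)}"

text \<open>Modules use the ring record; its fields \<open>mult\<close> and \<open>one\<close> carry no meaning for modules.\<close>

definition regular_module :: "('a, 'm) ring_scheme \<Rightarrow> ('a, 'a) module" where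
  "regular_module R = \<lparr>carrier = carrier R, monoid.mult = monoid.mult R, one = one R,
     zero = zero R, add = add R, smult = monoid.mult R\<rparr>"

definition free_module :: "('a, 'm) ring_scheme \<Rightarrow> nat \<Rightarrow> ('a, nat \<Rightarrow> 'a) module" where
  "free_module R n = \<lparr>carrier = {..<n} \<rightarrow>\<^sub>E carrier R, monoid.mult = undefined, one = undefined,
     zero = (\<lambda>i\<in>{..<n}. \<zero>\<^bsub>R\<^esub>), add = (\<lambda>x y. \<lambda>i\<in>{..<n}. x i \<oplus>\<^bsub>R\<^esub> y i),
     smult = (\<lambda>r x. \<lambda>i\<in>{..<n}. r \<otimes>\<^bsub>R\<^esub> x i)\<rparr>"

text \<open>\<open>M\<close> is a direct summand of a finite free module \<open>R\<^sup>n\<close>.\<close>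

definition fin_gen_projective :: "('a, 'm) ring_scheme \<Rightarrow> ('a, 'b, 'n) module_scheme \<Rightarrow> bool" where
  "fin_gen_projective R M \<longleftrightarrow> module R M \<and>
     (\<exists>n. \<exists>\<iota> \<in> linear_maps R M (free_module R n). \<exists>\<pi> \<in> linear_maps R (free_module R n) M.
        \<forall>x\<in>carrier M. \<pi> (\<iota> x) = x)"

definition dual_module ::
  "('a, 'm) ring_scheme \<Rightarrow> ('a, 'b, 'n) module_scheme \<Rightarrow> ('a, 'b \<Rightarrow> 'a) module"
where
  "dual_module R M = \<lparr>carrier = linear_maps R M (regular_module R) \<inter> extensional (carrier M),
     monoid.mult = undefined, one = undefined,
     zero = (\<lambda>x\<in>carrier M. \<zero>\<^bsub>R\<^esub>), add = (\<lambda>f g. \<lambda>x\<in>carrier M. f x \<oplus>\<^bsub>R\<^esub> g x),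
     smult = (\<lambda>r f. \<lambda>x\<in>carrier M. r \<otimes>\<^bsub>R\<^esub> f x)\<rparr>"

section \<open>The affine scheme of a finitely generated projective module\<close>

definition sym_ideal ::
  "('a, 'm) ring_scheme \<Rightarrow> ('a, 'c, 'n) module_scheme \<Rightarrow> ('c multiset \<Rightarrow> 'a) set"
where
  "sym_ideal R N = (let P = mpoly_ring R (carrier N); v = ring.indexed_var R in
     Idl\<^bsub>P\<^esub> ({v (x \<oplus>\<^bsub>N\<^esub> y) \<ominus>\<^bsub>P\<^esub> (v x \<oplus>\<^bsub>P\<^esub> v y) | x y. x \<in> carrier N \<and> y \<in> carrier N} \<union>
           {v (r \<odot>\<^bsub>N\<^esub> x) \<ominus>\<^bsub>P\<^esub> (ring.indexed_const R r \<otimes>\<^bsub>P\<^esub> v x) | r x. r \<in> carrier R \<and> x \<in> carrier N}))"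

definition sym_algebra ::
  "('a, 'm) ring_scheme \<Rightarrow> ('a, 'c, 'n) module_scheme \<Rightarrow> ('c multiset \<Rightarrow> 'a) set ring"
where
  "sym_algebra R N = mpoly_ring R (carrier N) Quot sym_ideal R N"

definition sym_const ::
  "('a, 'm) ring_scheme \<Rightarrow> ('a, 'c, 'n) module_scheme \<Rightarrow> 'a \<Rightarrow> ('c multiset \<Rightarrow> 'a) set"
where
  "sym_const R N r = sym_ideal R N +>\<^bsub>mpoly_ring R (carrier N)\<^esub> ring.indexed_const R r"

text \<open>For \<open>M\<close> finitely generated projective with dual \<open>M\<^sup>*\<close>, there are natural bijections
  \<open>M \<otimes>\<^sub>R T = Hom\<^sub>R(M\<^sup>*, T) = Hom\<^sub>R\<^sub>-\<^sub>a\<^sub>l\<^sub>g(Sym\<^sub>R(M\<^sup>*), T)\<close>, so the scheme \<open>W(M)\<close> that represents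
  the functor \<open>T \<mapsto> M \<otimes>\<^sub>R T\<close> is the spectrum of the ring \<open>W_ring R M = Sym\<^sub>R(M\<^sup>*)\<close>.\<close>

definition W_ring ::
  "('a, 'm) ring_scheme \<Rightarrow> ('a, 'b, 'n) module_scheme \<Rightarrow> (('b \<Rightarrow> 'a) multiset \<Rightarrow> 'a) set ring"
where
  "W_ring R M = sym_algebra R (dual_module R M)"

definition W_const ::
  "('a, 'm) ring_scheme \<Rightarrow> ('a, 'b, 'n) module_scheme \<Rightarrow> 'a \<Rightarrow> (('b \<Rightarrow> 'a) multiset \<Rightarrow> 'a) set"
where
  "W_const R M = sym_const R (dual_module R M)"

text \<open>The Zariski topology; its carrier set is the set of all prime ideals, the principal open
  subset of \<open>\<one>\<close>.\<close>

definition Spec :: "('a, 'm) ring_scheme \<Rightarrow> 'a set topology" where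
  "Spec A = topology_generated_by ((\<lambda>f. {p. primeideal p A \<and> f \<notin> p}) ` carrier A)"

text \<open>An open subscheme \<open>U\<close> of \<open>W(M)\<close> is given by its set of points, an open subset of the
  spectrum. A \<open>T\<close>-point of \<open>U\<close> is a \<open>T\<close>-point \<open>Spec T \<rightarrow> W(M)\<close> of \<open>W(M)\<close> over \<open>R\<close>, that is, a
  homomorphism of \<open>R\<close>-algebras, whose image is contained in \<open>U\<close>.\<close>

definition W_points ::
  "('a, 'm) ring_scheme \<Rightarrow> ('a, 'b, 'n) module_scheme \<Rightarrow> (('b \<Rightarrow> 'a) multiset \<Rightarrow> 'a) set set set \<Rightarrow>
   ('t, 'k) ring_scheme \<Rightarrow> ('a \<Rightarrow> 't) \<Rightarrow> ((('b \<Rightarrow> 'a) multiset \<Rightarrow> 'a) set \<Rightarrow> 't) set"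
where
  "W_points R M U T \<rho> = {\<phi> \<in> ring_hom (W_ring R M) T \<inter> extensional (carrier (W_ring R M)).
     (\<forall>r\<in>carrier R. \<phi> (W_const R M r) = \<rho> r) \<and>
     (\<forall>\<qq>. primeideal \<qq> T \<longrightarrow> {a \<in> carrier (W_ring R M). \<phi> a \<in> \<qq>} \<in> U)}"

text \<open>The underlying topological space of the scheme-theoretic fibre over \<open>s\<close> is the set of
  points lying over \<open>s\<close> with the subspace topology.\<close>

definition W_fibre ::
  "('a, 'm) ring_scheme \<Rightarrow> ('a, 'b, 'n) module_scheme \<Rightarrow> 'a set \<Rightarrow>
   (('b \<Rightarrow> 'a) multiset \<Rightarrow> 'a) set set topology"
where
  "W_fibre R M s = subtopology (Spec (W_ring R M)) {\<qq>. {r \<in> carrier R. W_const R M r \<in> \<qq>} = s}"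

text \<open>The fibres of \<open>W(M)\<close> are affine spaces over fields, hence reduced, so density and
  schematic density of open subschemes of the fibres are the same.\<close>

definition R_dense ::
  "('a, 'm) ring_scheme \<Rightarrow> ('a, 'b, 'n) module_scheme \<Rightarrow> (('b \<Rightarrow> 'a) multiset \<Rightarrow> 'a) set set set \<Rightarrow> bool"
where
  "R_dense R M U \<longleftrightarrow> (\<forall>s \<in> topspace (Spec R).
     W_fibre R M s closure_of (U \<inter> topspace (W_fibre R M s)) = topspace (W_fibre R M s))"

end

theory Submission
  imports Defs
begin

text \<open>
  The idea is to translate the existence of points of \<open>U\<close> into the representability of a unit by
  one polynomial \<open>F\<close> over \<open>R\<close>. Since \<open>M\<close> is a direct summand of some \<open>R\<^sup>n\<close>, the coordinate ring
  \<open>A = Sym(M\<^sup>*)\<close> of \<open>W(M)\<close> is a retract, as an \<open>R\<close>-algebra, of \<open>R[X\<^sub>1, \<dots>, X\<^sub>n]\<close>: there are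
  homomorphisms \<open>\<tau>\<close> from \<open>A\<close> to the polynomial ring and \<open>\<theta>\<close> back with \<open>\<theta> \<circ> \<tau> = id\<close>
  (\<open>W_ring_retract_of_mpoly_ring\<close>). A quasi-compact open \<open>U\<close> is the locus where one of finitely many
  functions \<open>f\<^sub>1, \<dots>, f\<^sub>k\<close> does not vanish (\<open>quasi_compact_open_in_Spec\<close>). Put
  \<open>F = \<Sum>\<^sub>j Y\<^sub>j \<tau>(f\<^sub>j)\<close> with new variables \<open>Y\<^sub>j\<close>. If \<open>F(x, y)\<close> is a unit, then the \<open>\<tau>(f\<^sub>j)(x)\<close>
  generate the unit ideal, so that evaluation at \<open>x\<close> composed with \<open>\<tau>\<close> is a point of \<open>U\<close>. On
  the other hand, each \<open>f\<^sub>j\<close> is a value of \<open>F\<close> over \<open>A\<close> (\<open>unit_polynomial_for_open\<close>).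

  For the local-global statement, a point of \<open>U\<close> over the field \<open>R/\<mm>\<close> makes some \<open>f\<^sub>j\<close> nonzero,
  hence a unit, and so \<open>F\<close> represents a unit over \<open>R/\<mm>\<close>. The LG property then yields a unit value
  of \<open>F\<close> over \<open>R\<close>. The converse is composition with \<open>R \<rightarrow> R/\<mm>\<close>.

  For the second statement, suppose that the coefficients of \<open>F\<close> lie in a maximal ideal \<open>\<mm>\<close>. By
  density there is a prime \<open>\<qq>\<close> of \<open>A\<close> over \<open>\<mm>\<close> that belongs to \<open>U\<close>. Every value of \<open>F\<close> over
  \<open>A\<close> lies in \<open>\<mm>A \<subseteq> \<qq>\<close>, in particular every \<open>f\<^sub>j\<close>, which contradicts \<open>\<qq> \<in> U\<close>. So \<open>F\<close> is
  primitive. The primitive criterion concerns one variable, but the substitution of powers of one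
  variable with exponents \<open>b\<^sup>i\<close> for a large base \<open>b\<close> preserves the set of nonzero coefficients, so it
  also applies to \<open>F\<close> (\<open>primitive_criterion_multivariate\<close>).
\<close>

section \<open>The universal property of multivariate polynomial rings\<close>

definition monomial_value :: "('s, 'k) ring_scheme \<Rightarrow> ('i \<Rightarrow> 's) \<Rightarrow> 'i multiset \<Rightarrow> 's" where
  "monomial_value S s m = (\<Otimes>\<^bsub>S\<^esub>i\<in>set_mset m. s i [^]\<^bsub>S\<^esub> count m i)"

lemma mpoly_eval_alt:
  "mpoly_eval R S \<rho> s P = (\<Oplus>\<^bsub>S\<^esub>m\<in>{m. P m \<noteq> \<zero>\<^bsub>R\<^esub>}. \<rho> (P m) \<otimes>\<^bsub>S\<^esub> monomial_value S s m)"
  by (simp add: mpoly_eval_def monomial_value_def)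

context cring
begin

lemma monomial_value_closed [simp]:
  "(\<And>i. i \<in># m \<Longrightarrow> s i \<in> carrier R) \<Longrightarrow> monomial_value R s m \<in> carrier R"
  unfolding monomial_value_def by (auto intro!: finprod_closed)

lemma monomial_value_superset:
  assumes "finite A" "set_mset m \<subseteq> A" "s \<in> A \<rightarrow> carrier R"
  shows "monomial_value R s m = (\<Otimes>i\<in>A. s i [^] count m i)"
  unfolding monomial_value_def using assms
  by (intro finprod_mono_neutral_cong_left) (auto simp: not_in_iff)

lemma monomial_value_empty [simp]: "monomial_value R s {#} = \<one>"
  by (simp add: monomial_value_def)

lemma monomial_value_single:
  "s i \<in> carrier R \<Longrightarrow> monomial_value R s {#i#} = s i"
  by (simp add: monomial_value_def)

lemma monomial_value_add:
  assumes "\<And>i. i \<in># m + m' \<Longrightarrow> s i \<in> carrier R"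
  shows "monomial_value R s (m + m') = monomial_value R s m \<otimes> monomial_value R s m'"
proof -
  let ?A = "set_mset (m + m')"
  have s: "s \<in> ?A \<rightarrow> carrier R" using assms by auto
  have "monomial_value R s (m + m') = (\<Otimes>i\<in>?A. s i [^] count m i \<otimes> s i [^] count m' i)"
    unfolding monomial_value_def using assms
    by (intro finprod_cong') (auto simp: nat_pow_mult)
  also have "\<dots> = (\<Otimes>i\<in>?A. s i [^] count m i) \<otimes> (\<Otimes>i\<in>?A. s i [^] count m' i)"
    using assms by (intro finprod_multf) auto
  also have "\<dots> = monomial_value R s m \<otimes> monomial_value R s m'"
    by (subst (1 2) monomial_value_superset[of ?A]) (use s in auto)
  finally show ?thesis .
qed

end

lemma mpoly_carrierD:
  assumes "P \<in> carrier (mpoly_ring R I)"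
  shows "P m \<in> carrier R" "finite {m. P m \<noteq> \<zero>\<^bsub>R\<^esub>}" "P m \<noteq> \<zero>\<^bsub>R\<^esub> \<Longrightarrow> i \<in># m \<Longrightarrow> i \<in> I"
  using assms by (auto simp: mpoly_ring_def)

context ring_hom_cring
begin

text \<open>The support of a sum or product is in general strictly smaller than the set of monomials that
  its terms suggest. Summing over a larger set is harmless only if all its monomials use
  variables in \<open>I\<close>, because \<open>s\<close> need not take values in \<open>S\<close> outside \<open>I\<close>.\<close>

lemma mpoly_eval_superset:
  assumes "P \<in> carrier (mpoly_ring R I)" "s \<in> I \<rightarrow> carrier S" "finite D"
    "{m. P m \<noteq> \<zero>} \<subseteq> D" "\<And>m i. m \<in> D \<Longrightarrow> i \<in># m \<Longrightarrow> i \<in> I"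
  shows "mpoly_eval R S h s P = (\<Oplus>\<^bsub>S\<^esub>m\<in>D. h (P m) \<otimes>\<^bsub>S\<^esub> monomial_value S s m)"
  unfolding mpoly_eval_alt
proof (rule S.add.finprod_mono_neutral_cong_left)
  have v: "monomial_value S s m \<in> carrier S" if "m \<in> D" for m
    using assms(2,5) that by (intro S.monomial_value_closed) (auto simp: Pi_iff)
  show "(\<lambda>m. h (P m) \<otimes>\<^bsub>S\<^esub> monomial_value S s m) \<in> D \<rightarrow> carrier S"
    using v mpoly_carrierD(1)[OF assms(1)] by auto
  show "\<And>m. m \<in> D - {m. P m \<noteq> \<zero>} \<Longrightarrow> h (P m) \<otimes>\<^bsub>S\<^esub> monomial_value S s m = \<zero>\<^bsub>S\<^esub>"
    using v by simp
qed (use assms in auto)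

lemma mpoly_eval_closed:
  assumes "P \<in> carrier (mpoly_ring R I)" "s \<in> I \<rightarrow> carrier S"
  shows "mpoly_eval R S h s P \<in> carrier S"
  unfolding mpoly_eval_alt using assms mpoly_carrierD[OF assms(1)]
  by (intro S.finsum_closed) (auto intro!: S.m_closed S.monomial_value_closed)

lemma mpoly_eval_add:
  assumes P: "P \<in> carrier (mpoly_ring R I)" and Q: "Q \<in> carrier (mpoly_ring R I)"
    and s: "s \<in> I \<rightarrow> carrier S"
  shows "mpoly_eval R S h s (P \<oplus>\<^bsub>mpoly_ring R I\<^esub> Q) = mpoly_eval R S h s P \<oplus>\<^bsub>S\<^esub> mpoly_eval R S h s Q"
proof -
  let ?D = "{m. P m \<noteq> \<zero>} \<union> {m. Q m \<noteq> \<zero>}"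
  let ?PQ = "P \<oplus>\<^bsub>mpoly_ring R I\<^esub> Q"
  have D: "finite ?D" "\<And>m i. m \<in> ?D \<Longrightarrow> i \<in># m \<Longrightarrow> i \<in> I"
    using mpoly_carrierD[OF P] mpoly_carrierD[OF Q] by auto
  have e: "?PQ = (\<lambda>m. P m \<oplus> Q m)" by (simp add: mpoly_ring_ops[OF R.ring_axioms])
  have PQ: "?PQ \<in> carrier (mpoly_ring R I)"
    using P Q cring.cring_simprules(1)[OF R.cring_mpoly_ring] by blast
  have v: "monomial_value S s m \<in> carrier S" if "m \<in> ?D" for m
    using D s that by (intro S.monomial_value_closed) (auto simp: Pi_iff)
  have sup: "mpoly_eval R S h s F = (\<Oplus>\<^bsub>S\<^esub>m\<in>?D. h (F m) \<otimes>\<^bsub>S\<^esub> monomial_value S s m)"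
    if "F \<in> carrier (mpoly_ring R I)" "{m. F m \<noteq> \<zero>} \<subseteq> ?D" for F
    using that s D by (intro mpoly_eval_superset) auto
  have "mpoly_eval R S h s ?PQ = (\<Oplus>\<^bsub>S\<^esub>m\<in>?D. h (?PQ m) \<otimes>\<^bsub>S\<^esub> monomial_value S s m)"
    using PQ by (rule sup) (auto simp: e)
  also have "\<dots> = (\<Oplus>\<^bsub>S\<^esub>m\<in>?D. h (P m) \<otimes>\<^bsub>S\<^esub> monomial_value S s m \<oplus>\<^bsub>S\<^esub> h (Q m) \<otimes>\<^bsub>S\<^esub> monomial_value S s m)"
    using v mpoly_carrierD(1)[OF P] mpoly_carrierD(1)[OF Q]
    by (intro S.finsum_cong') (auto simp: e S.l_distr)
  also have "\<dots> = (\<Oplus>\<^bsub>S\<^esub>m\<in>?D. h (P m) \<otimes>\<^bsub>S\<^esub> monomial_value S s m) \<oplus>\<^bsub>S\<^esub>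
      (\<Oplus>\<^bsub>S\<^esub>m\<in>?D. h (Q m) \<otimes>\<^bsub>S\<^esub> monomial_value S s m)"
    using v mpoly_carrierD(1)[OF P] mpoly_carrierD(1)[OF Q] by (intro S.finsum_addf) auto
  also have "\<dots> = mpoly_eval R S h s P \<oplus>\<^bsub>S\<^esub> mpoly_eval R S h s Q"
    by (subst (1 2) sup) (use P Q in auto)
  finally show ?thesis .
qed

lemma mpoly_eval_mult:
  assumes P: "P \<in> carrier (mpoly_ring R I)" and Q: "Q \<in> carrier (mpoly_ring R I)"
    and s: "s \<in> I \<rightarrow> carrier S"
  shows "mpoly_eval R S h s (P \<otimes>\<^bsub>mpoly_ring R I\<^esub> Q) = mpoly_eval R S h s P \<otimes>\<^bsub>S\<^esub> mpoly_eval R S h s Q"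
proof -
  let ?A = "{m. P m \<noteq> \<zero>}" and ?B = "{m. Q m \<noteq> \<zero>}" and ?PQ = "P \<otimes>\<^bsub>mpoly_ring R I\<^esub> Q"
  let ?D = "(\<lambda>(a, b). a + b) ` (?A \<times> ?B)" and ?v = "monomial_value S s"
  note Pc [simp] = mpoly_carrierD(1)[OF P] and Qc [simp] = mpoly_carrierD(1)[OF Q]
  have fin [simp]: "finite ?A" "finite ?B" "finite ?D"
    using mpoly_carrierD(2)[OF P] mpoly_carrierD(2)[OF Q] by auto
  have A: "\<And>m i. m \<in> ?A \<Longrightarrow> i \<in># m \<Longrightarrow> i \<in> I" and B: "\<And>m i. m \<in> ?B \<Longrightarrow> i \<in># m \<Longrightarrow> i \<in> I"
    using mpoly_carrierD(3)[OF P] mpoly_carrierD(3)[OF Q] by auto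
  have D: "\<And>m i. m \<in> ?D \<Longrightarrow> i \<in># m \<Longrightarrow> i \<in> I" using A B by auto
  have e: "?PQ = (\<lambda>m. \<Oplus>a\<in>{a. a \<subseteq># m}. P a \<otimes> Q (m - a))"
    by (simp add: mpoly_ring_ops[OF R.ring_axioms])
  have PQ: "?PQ \<in> carrier (mpoly_ring R I)"
    using P Q cring.cring_simprules(5)[OF R.cring_mpoly_ring] by blast
  have v: "?v m \<in> carrier S" if "\<And>i. i \<in># m \<Longrightarrow> i \<in> I" for m
    using s that by (intro S.monomial_value_closed) (auto simp: Pi_iff)
  have vA: "?v a \<in> carrier S" if "a \<in> ?A" for a by (rule v) (use A that in blast)
  have vB: "?v b \<in> carrier S" if "b \<in> ?B" for b by (rule v) (use B that in blast)
  have vD: "?v m \<in> carrier S" if "m \<in> ?D" for m by (rule v) (use D that in blast)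
  have coeff: "?PQ m = (\<Oplus>a\<in>{a\<in>?A. a \<subseteq># m}. P a \<otimes> Q (m - a))" for m
    unfolding e by (rule R.add.finprod_mono_neutral_cong_right) (auto simp: R.finite_submsets)
  have "mpoly_eval R S h s ?PQ = (\<Oplus>\<^bsub>S\<^esub>m\<in>?D. h (?PQ m) \<otimes>\<^bsub>S\<^esub> ?v m)"
    using R.mpoly_mult_supp[of P Q] PQ s D
    by (intro mpoly_eval_superset[of _ I]) (auto simp: e)
  also have "\<dots> = (\<Oplus>\<^bsub>S\<^esub>m\<in>?D. \<Oplus>\<^bsub>S\<^esub>a\<in>{a\<in>?A. a \<subseteq># m}. h (P a) \<otimes>\<^bsub>S\<^esub> h (Q (m - a)) \<otimes>\<^bsub>S\<^esub> ?v m)"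
  proof (rule S.finsum_cong')
    fix m assume m: "m \<in> ?D"
    show "h (?PQ m) \<otimes>\<^bsub>S\<^esub> ?v m = (\<Oplus>\<^bsub>S\<^esub>a\<in>{a\<in>?A. a \<subseteq># m}. h (P a) \<otimes>\<^bsub>S\<^esub> h (Q (m - a)) \<otimes>\<^bsub>S\<^esub> ?v m)"
      unfolding coeff by (subst hom_finsum) (auto simp: S.finsum_ldistr vD[OF m] o_def)
  qed (auto intro!: S.finsum_closed vD)
  \<comment> \<open>Exchange the sums, so that the monomial \<open>a\<close> of \<open>P\<close> comes first; then \<open>m\<close> runs over the
    multiples of \<open>a\<close>, and only those of the form \<open>a + b\<close> with \<open>b\<close> in the support of \<open>Q\<close> count.\<close>
  also have "\<dots> = (\<Oplus>\<^bsub>S\<^esub>a\<in>?A. \<Oplus>\<^bsub>S\<^esub>m\<in>{m\<in>?D. a \<subseteq># m}. h (P a) \<otimes>\<^bsub>S\<^esub> h (Q (m - a)) \<otimes>\<^bsub>S\<^esub> ?v m)"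
    by (rule S.finsum_swap_dep) (use vD in auto)
  also have "\<dots> = (\<Oplus>\<^bsub>S\<^esub>a\<in>?A. h (P a) \<otimes>\<^bsub>S\<^esub> ?v a \<otimes>\<^bsub>S\<^esub> (\<Oplus>\<^bsub>S\<^esub>b\<in>?B. h (Q b) \<otimes>\<^bsub>S\<^esub> ?v b))"
  proof (rule S.finsum_cong')
    fix a assume a: "a \<in> ?A"
    have "(\<Oplus>\<^bsub>S\<^esub>m\<in>{m\<in>?D. a \<subseteq># m}. h (P a) \<otimes>\<^bsub>S\<^esub> h (Q (m - a)) \<otimes>\<^bsub>S\<^esub> ?v m) =
      (\<Oplus>\<^bsub>S\<^esub>m\<in>(+) a ` ?B. h (P a) \<otimes>\<^bsub>S\<^esub> h (Q (m - a)) \<otimes>\<^bsub>S\<^esub> ?v m)"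
    proof (rule S.add.finprod_mono_neutral_cong_right)
      fix m assume m: "m \<in> {m\<in>?D. a \<subseteq># m} - (+) a ` ?B"
      then have "m = a + (m - a)" by (metis (mono_tags, lifting) DiffD1 mem_Collect_eq subset_mset.add_diff_inverse)
      then have "Q (m - a) = \<zero>" using m by blast
      then show "h (P a) \<otimes>\<^bsub>S\<^esub> h (Q (m - a)) \<otimes>\<^bsub>S\<^esub> ?v m = \<zero>\<^bsub>S\<^esub>" using m vD by simp
    qed (use a vD in auto)
    also have "\<dots> = (\<Oplus>\<^bsub>S\<^esub>b\<in>?B. h (P a) \<otimes>\<^bsub>S\<^esub> h (Q (a + b - a)) \<otimes>\<^bsub>S\<^esub> ?v (a + b))"
      by (rule S.finsum_reindex) (use a vD in \<open>auto intro!: S.m_closed\<close>)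
    also have "\<dots> = (\<Oplus>\<^bsub>S\<^esub>b\<in>?B. (h (P a) \<otimes>\<^bsub>S\<^esub> ?v a) \<otimes>\<^bsub>S\<^esub> (h (Q b) \<otimes>\<^bsub>S\<^esub> ?v b))"
    proof (rule S.finsum_cong')
      fix b assume b: "b \<in> ?B"
      have "?v (a + b) = ?v a \<otimes>\<^bsub>S\<^esub> ?v b"
        using A[OF a] B[OF b] s by (intro S.monomial_value_add) auto
      then show "h (P a) \<otimes>\<^bsub>S\<^esub> h (Q (a + b - a)) \<otimes>\<^bsub>S\<^esub> ?v (a + b) =
          (h (P a) \<otimes>\<^bsub>S\<^esub> ?v a) \<otimes>\<^bsub>S\<^esub> (h (Q b) \<otimes>\<^bsub>S\<^esub> ?v b)"
        using vA[OF a] vB[OF b] by (simp add: S.m_ac)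
    qed (use vA[OF a] vB in auto)
    also have "\<dots> = h (P a) \<otimes>\<^bsub>S\<^esub> ?v a \<otimes>\<^bsub>S\<^esub> (\<Oplus>\<^bsub>S\<^esub>b\<in>?B. h (Q b) \<otimes>\<^bsub>S\<^esub> ?v b)"
      by (rule S.finsum_rdistr[symmetric]) (use vA[OF a] vB in auto)
    finally show "(\<Oplus>\<^bsub>S\<^esub>m\<in>{m\<in>?D. a \<subseteq># m}. h (P a) \<otimes>\<^bsub>S\<^esub> h (Q (m - a)) \<otimes>\<^bsub>S\<^esub> ?v m) =
      h (P a) \<otimes>\<^bsub>S\<^esub> ?v a \<otimes>\<^bsub>S\<^esub> (\<Oplus>\<^bsub>S\<^esub>b\<in>?B. h (Q b) \<otimes>\<^bsub>S\<^esub> ?v b)" .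
  qed (use vA vB in \<open>auto intro!: S.m_closed S.finsum_closed\<close>)
  also have "\<dots> = mpoly_eval R S h s P \<otimes>\<^bsub>S\<^esub> mpoly_eval R S h s Q"
    unfolding mpoly_eval_alt
    by (rule S.finsum_ldistr[symmetric]) (use vA vB in \<open>auto intro!: S.finsum_closed\<close>)
  finally show ?thesis .
qed

lemma mpoly_eval_const:
  fixes s :: "'i \<Rightarrow> 'c"
  assumes "r \<in> carrier R"
  shows "mpoly_eval R S h s (R.indexed_const r) = h r"
proof -
  have "{m. (R.indexed_const r :: 'i multiset \<Rightarrow> 'a) m \<noteq> \<zero>} = (if r = \<zero> then {} else {{#}})"
    by (auto simp: R.indexed_const_def)
  moreover have "(R.indexed_const r :: 'i multiset \<Rightarrow> 'a) {#} = r" by (simp add: R.indexed_const_def)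
  ultimately show ?thesis using assms unfolding mpoly_eval_alt by simp
qed

text \<open>The existence half of the universal property of \<open>R[X\<^sub>i | i \<in> I]\<close>; the uniqueness half is
  \<open>mpoly_hom_eq_eval\<close>.\<close>

theorem mpoly_eval_ring_hom:
  assumes "s \<in> I \<rightarrow> carrier S"
  shows "mpoly_eval R S h s \<in> ring_hom (mpoly_ring R I) S"
proof (rule ring_hom_memI)
  have "\<one>\<^bsub>mpoly_ring R I\<^esub> = R.indexed_const \<one>" by (simp add: mpoly_ring_def)
  then show "mpoly_eval R S h s \<one>\<^bsub>mpoly_ring R I\<^esub> = \<one>\<^bsub>S\<^esub>" by (simp add: mpoly_eval_const)
qed (use assms in \<open>auto intro!: mpoly_eval_closed mpoly_eval_mult mpoly_eval_add\<close>)

end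

definition monomial_poly :: "('a, 'm) ring_scheme \<Rightarrow> 'a \<Rightarrow> 'i multiset \<Rightarrow> 'i multiset \<Rightarrow> 'a" where
  "monomial_poly R c m = (\<lambda>m'. if m' = m then c else \<zero>\<^bsub>R\<^esub>)"

lemma mpoly_eval_cong:
  assumes "F \<in> carrier (mpoly_ring R I)" "cring S" "\<rho> \<in> ring_hom R S" "s \<in> I \<rightarrow> carrier S"
    "\<And>r. r \<in> carrier R \<Longrightarrow> \<rho> r = \<rho>' r" "\<And>i. i \<in> I \<Longrightarrow> s i = s' i"
  shows "mpoly_eval R S \<rho> s F = mpoly_eval R S \<rho>' s' F"
proof -
  interpret S: cring S by fact
  note F = mpoly_carrierD[OF assms(1)]
  have "monomial_value S s m = monomial_value S s' m" "monomial_value S s m \<in> carrier S"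
    if "F m \<noteq> \<zero>\<^bsub>R\<^esub>" for m
    using F(3)[OF that] assms(4,6) unfolding monomial_value_def
    by (auto intro!: S.finprod_cong' S.finprod_closed simp: Pi_iff)
  then show ?thesis
    unfolding mpoly_eval_alt using F(1) assms(5) ring_hom_closed[OF assms(3)]
    by (intro S.finsum_cong') (auto intro!: S.m_closed)
qed

lemma mpoly_carrier_mono:
  "I \<subseteq> J \<Longrightarrow> F \<in> carrier (mpoly_ring R I) \<Longrightarrow> F \<in> carrier (mpoly_ring R J)"
  by (auto simp: mpoly_ring_def)

context cring
begin

lemma monomial_poly_carrier:
  "c \<in> carrier R \<Longrightarrow> set_mset m \<subseteq> I \<Longrightarrow> monomial_poly R c m \<in> carrier (mpoly_ring R I)"
  by (auto simp: mpoly_ring_def monomial_poly_def)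

lemma indexed_const_eq_monomial: "indexed_const c = monomial_poly R c {#}"
  by (simp add: indexed_const_def monomial_poly_def)

lemma indexed_var_eq_monomial: "indexed_var i = monomial_poly R \<one> {#i#}"
  unfolding indexed_var_def indexed_pmult_def indexed_const_def monomial_poly_def
  by (auto simp: fun_eq_iff) (metis insert_DiffM)

lemma monomial_poly_mult:
  assumes [simp]: "c \<in> carrier R" "d \<in> carrier R"
  shows "monomial_poly R c m \<otimes>\<^bsub>mpoly_ring R I\<^esub> monomial_poly R d m' = monomial_poly R (c \<otimes> d) (m + m')"
proof
  fix n
  have [simp]: "monomial_poly R c m a \<in> carrier R" "monomial_poly R d m' a \<in> carrier R" for a
    by (auto simp: monomial_poly_def)
  have "(monomial_poly R c m \<otimes>\<^bsub>mpoly_ring R I\<^esub> monomial_poly R d m') n =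
      (\<Oplus>a\<in>{a. a \<subseteq># n}. monomial_poly R c m a \<otimes> monomial_poly R d m' (n - a))"
    by (simp add: mpoly_ring_ops[OF ring_axioms])
  also have "\<dots> = (\<Oplus>a\<in>{a. a \<subseteq># n}. if a = m then monomial_poly R (c \<otimes> d) (m + m') n else \<zero>)"
  proof (rule finsum_cong')
    fix a assume "a \<in> {a. a \<subseteq># n}"
    then have "n = a + (n - a)" by (metis mem_Collect_eq subset_mset.add_diff_inverse)
    then have "n - a = m' \<longleftrightarrow> n = a + m'" by auto
    then show "monomial_poly R c m a \<otimes> monomial_poly R d m' (n - a) =
        (if a = m then monomial_poly R (c \<otimes> d) (m + m') n else \<zero>)"
      by (auto simp: monomial_poly_def)
  qed (auto simp: monomial_poly_def)
  also have "\<dots> = monomial_poly R (c \<otimes> d) (m + m') n"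
  proof (cases "m \<subseteq># n")
    case True
    then show ?thesis
      using add.finprod_singleton_swap[of m "{a. a \<subseteq># n}" "\<lambda>_. monomial_poly R (c \<otimes> d) (m + m') n"]
      by (auto simp: finite_submsets monomial_poly_def)
  next
    case False
    then have "n \<noteq> m + m'" by auto
    moreover have "(\<Oplus>a\<in>{a. a \<subseteq># n}. if a = m then monomial_poly R (c \<otimes> d) (m + m') n else \<zero>) = \<zero>"
      using False by (intro add.finprod_one_eqI) auto
    ultimately show ?thesis by (simp add: monomial_poly_def)
  qed
  finally show "(monomial_poly R c m \<otimes>\<^bsub>mpoly_ring R I\<^esub> monomial_poly R d m') n =
      monomial_poly R (c \<otimes> d) (m + m') n" .
qed

lemma indexed_const_carrier: "c \<in> carrier R \<Longrightarrow> indexed_const c \<in> carrier (mpoly_ring R I)"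
  by (simp add: indexed_const_eq_monomial monomial_poly_carrier)

lemma indexed_var_carrier: "i \<in> I \<Longrightarrow> indexed_var i \<in> carrier (mpoly_ring R I)"
  by (simp add: indexed_var_eq_monomial monomial_poly_carrier)

lemma indexed_const_ring_hom: "indexed_const \<in> ring_hom R (mpoly_ring R I)"
proof (rule ring_hom_memI)
  show "indexed_const \<one> = \<one>\<^bsub>mpoly_ring R I\<^esub>" by (simp add: mpoly_ring_def)
  show "indexed_const (x \<oplus> y) = indexed_const x \<oplus>\<^bsub>mpoly_ring R I\<^esub> indexed_const y"
    if "x \<in> carrier R" "y \<in> carrier R" for x y
    using that by (auto simp: mpoly_ring_ops[OF ring_axioms] indexed_const_def)
qed (auto simp: indexed_const_eq_monomial monomial_poly_carrier monomial_poly_mult)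

lemma monomial_value_indexed_var:
  assumes "set_mset m \<subseteq> I"
  shows "monomial_value (mpoly_ring R I) indexed_var m = monomial_poly R \<one> m"
proof -
  interpret P: cring "mpoly_ring R I" by (rule cring_mpoly_ring)
  show ?thesis using assms
  proof (induction m)
    case empty
    show ?case by (simp add: mpoly_ring_ops(1)[OF ring_axioms] monomial_poly_def)
  next
    case (add i m)
    then have v: "indexed_var j \<in> carrier (mpoly_ring R I)" if "j \<in># add_mset i m" for j
      using that by (auto intro: indexed_var_carrier)
    have "monomial_value (mpoly_ring R I) indexed_var (m + {#i#}) =
        monomial_value (mpoly_ring R I) indexed_var m \<otimes>\<^bsub>mpoly_ring R I\<^esub>
        monomial_value (mpoly_ring R I) indexed_var {#i#}"
      using v by (intro P.monomial_value_add) auto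
    also have "monomial_value (mpoly_ring R I) indexed_var {#i#} = monomial_poly R \<one> {#i#}"
      using v by (subst P.monomial_value_single) (auto simp: indexed_var_eq_monomial)
    finally show ?case using add by (simp add: monomial_poly_mult)
  qed
qed

lemma mpoly_finsum_coeff:
  assumes "finite A" "f \<in> A \<rightarrow> carrier (mpoly_ring R I)"
  shows "(\<Oplus>\<^bsub>mpoly_ring R I\<^esub>a\<in>A. f a) m = (\<Oplus>a\<in>A. f a m)"
proof -
  interpret P: cring "mpoly_ring R I" by (rule cring_mpoly_ring)
  show ?thesis using assms
  proof (induction A rule: finite_induct)
    case empty
    show ?case by (simp add: mpoly_ring_ops[OF ring_axioms])
  next
    case (insert a A)
    then have "f a \<in> carrier (mpoly_ring R I)" "f \<in> A \<rightarrow> carrier (mpoly_ring R I)" by auto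
    moreover have "(\<lambda>a. f a m) \<in> A \<rightarrow> carrier R" "f a m \<in> carrier R"
      using mpoly_carrierD(1)[of "f _" R I] insert.prems by (auto simp: Pi_iff)
    ultimately show ?case
      using insert by (simp add: mpoly_ring_ops(3)[OF ring_axioms])
  qed
qed

text \<open>Every polynomial is the sum of its terms, and each term is a constant times a product of
  variables. Hence a homomorphism is determined by its values on constants and variables.\<close>

theorem mpoly_eval_self:
  assumes "F \<in> carrier (mpoly_ring R I)"
  shows "mpoly_eval R (mpoly_ring R I) indexed_const indexed_var F = F"
proof
  interpret P: cring "mpoly_ring R I" by (rule cring_mpoly_ring)
  fix n
  note F = mpoly_carrierD[OF assms]
  have "mpoly_eval R (mpoly_ring R I) indexed_const indexed_var F =
      (\<Oplus>\<^bsub>mpoly_ring R I\<^esub>m\<in>{m. F m \<noteq> \<zero>}. monomial_poly R (F m) m)"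
    unfolding mpoly_eval_alt
  proof (rule P.finsum_cong')
    fix m assume "m \<in> {m. F m \<noteq> \<zero>}"
    then have "set_mset m \<subseteq> I" using F(3) by blast
    then show "indexed_const (F m) \<otimes>\<^bsub>mpoly_ring R I\<^esub> monomial_value (mpoly_ring R I) indexed_var m =
        monomial_poly R (F m) m"
      using F(1) by (simp add: monomial_value_indexed_var indexed_const_eq_monomial monomial_poly_mult)
  qed (use F in \<open>auto intro!: monomial_poly_carrier\<close>)
  then have "mpoly_eval R (mpoly_ring R I) indexed_const indexed_var F n =
      (\<Oplus>m\<in>{m. F m \<noteq> \<zero>}. monomial_poly R (F m) m n)"
    using F by (subst mpoly_finsum_coeff[symmetric]) (auto intro!: monomial_poly_carrier)
  also have "\<dots> = (\<Oplus>m\<in>{m. F m \<noteq> \<zero>}. if m = n then F m else \<zero>)"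
    using F(1) by (intro finsum_cong') (auto simp: monomial_poly_def)
  also have "\<dots> = F n"
  proof (cases "F n = \<zero>")
    case True
    then show ?thesis by (auto intro!: add.finprod_one_eqI)
  next
    case False
    then show ?thesis using F by (subst add.finprod_singleton_swap) auto
  qed
  finally show "mpoly_eval R (mpoly_ring R I) indexed_const indexed_var F n = F n" .
qed

end

context ring_hom_cring
begin

lemma hom_monomial_value:
  assumes "\<And>i. i \<in># m \<Longrightarrow> s i \<in> carrier R"
  shows "h (monomial_value R s m) = monomial_value S (h \<circ> s) m"
  unfolding monomial_value_def using assms by (subst hom_finprod) (auto intro!: S.finprod_cong')

lemma mpoly_eval_var:
  assumes "s i \<in> carrier S"
  shows "mpoly_eval R S h s (R.indexed_var i) = s i"
\<comment> \<open>Over the zero ring a variable is the zero polynomial, and its evaluation is an empty sum.\<close>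
proof (cases "\<one> = \<zero>")
  case True
  then have "\<zero>\<^bsub>S\<^esub> = \<one>\<^bsub>S\<^esub>" using hom_one hom_zero by simp
  then have *: "x = \<zero>\<^bsub>S\<^esub>" if "x \<in> carrier S" for x using that by (metis S.l_one S.l_null)
  have "mpoly_eval R S h s (R.indexed_var i) \<in> carrier S"
    using assms by (intro mpoly_eval_closed[of _ "{i}"] R.indexed_var_carrier) auto
  then show ?thesis using *[of "mpoly_eval R S h s (R.indexed_var i)"] *[OF assms] by simp
next
  case False
  then have "{m. R.indexed_var i m \<noteq> \<zero>} = {{#i#}}"
    by (auto simp: R.indexed_var_eq_monomial monomial_poly_def)
  moreover have "R.indexed_var i {#i#} = \<one>" by (auto simp: R.indexed_var_eq_monomial monomial_poly_def)
  ultimately show ?thesis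
    using assms unfolding mpoly_eval_alt by (simp add: S.monomial_value_single)
qed

end

lemma hom_mpoly_eval:
  assumes "ring_hom_cring R S \<rho>" "ring_hom_cring S T g"
    "F \<in> carrier (mpoly_ring R I)" "s \<in> I \<rightarrow> carrier S"
  shows "g (mpoly_eval R S \<rho> s F) = mpoly_eval R T (g \<circ> \<rho>) (g \<circ> s) F"
proof -
  interpret h: ring_hom_cring R S \<rho> by fact
  interpret g: ring_hom_cring S T g by fact
  note F = mpoly_carrierD[OF assms(3)]
  have s: "s i \<in> carrier S" if "F m \<noteq> \<zero>\<^bsub>R\<^esub>" "i \<in># m" for i m using assms(4) F(3) that by auto
  have "g (mpoly_eval R S \<rho> s F) =
      (\<Oplus>\<^bsub>T\<^esub>m\<in>{m. F m \<noteq> \<zero>\<^bsub>R\<^esub>}. (g \<circ> (\<lambda>m. \<rho> (F m) \<otimes>\<^bsub>S\<^esub> monomial_value S s m)) m)"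
    unfolding mpoly_eval_alt using F s by (intro g.hom_finsum) (auto intro!: h.S.m_closed)
  also have "\<dots> = mpoly_eval R T (g \<circ> \<rho>) (g \<circ> s) F"
    unfolding mpoly_eval_alt using F s
    by (intro g.S.finsum_cong') (auto simp: g.hom_monomial_value intro!: g.S.m_closed)
  finally show ?thesis .
qed

lemma mpoly_hom_eq_eval:
  assumes "cring R" "cring S" "g \<in> ring_hom (mpoly_ring R I) S" "F \<in> carrier (mpoly_ring R I)"
  shows "g F = mpoly_eval R S (\<lambda>r. g (ring.indexed_const R r)) (\<lambda>i. g (ring.indexed_var R i)) F"
proof -
  interpret R: cring R by fact
  have "g F = g (mpoly_eval R (mpoly_ring R I) R.indexed_const R.indexed_var F)"
    by (simp add: R.mpoly_eval_self[OF assms(4)])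
  also have "\<dots> = mpoly_eval R S (g \<circ> R.indexed_const) (g \<circ> R.indexed_var) F"
    using assms R.indexed_const_ring_hom R.cring_mpoly_ring
    by (intro hom_mpoly_eval[where I = I])
      (auto intro!: ring_hom_cring.intro ring_hom_cring_axioms.intro R.indexed_var_carrier)
  finally show ?thesis by (simp add: o_def)
qed

section \<open>The universal property of symmetric algebras\<close>

lemma coset_eq_if_minus_mem:
  assumes "ideal J P" "a \<in> carrier P" "b \<in> carrier P" "a \<ominus>\<^bsub>P\<^esub> b \<in> J"
  shows "J +>\<^bsub>P\<^esub> a = J +>\<^bsub>P\<^esub> b"
proof -
  interpret ideal J P by fact
  have "a \<in> J +>\<^bsub>P\<^esub> b" using a_rcos_module_minus[OF ring_axioms assms(3,2)] assms(4) by simp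
  then show ?thesis using a_repr_independence'[OF _ assms(3)] by simp
qed

lemma quotient_ring_lift:
  assumes "ideal J P" "cring P" "cring S" "h \<in> ring_hom P S" "\<And>x. x \<in> J \<Longrightarrow> h x = \<zero>\<^bsub>S\<^esub>"
  obtains g where "g \<in> ring_hom (P Quot J) S" "\<And>x. x \<in> carrier P \<Longrightarrow> g (J +>\<^bsub>P\<^esub> x) = h x"
proof
  interpret J: ideal J P by fact
  interpret h: ring_hom_cring P S h
    using assms by (auto intro!: ring_hom_cring.intro ring_hom_cring_axioms.intro)
  define g where "g = (\<lambda>C. h (SOME x. x \<in> carrier P \<and> C = J +>\<^bsub>P\<^esub> x))"
  have eq: "h x = h y" if "x \<in> carrier P" "y \<in> carrier P" "J +>\<^bsub>P\<^esub> x = J +>\<^bsub>P\<^esub> y" for x y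
  proof -
    have "x \<in> J +>\<^bsub>P\<^esub> y" using J.a_rcos_self[OF that(1)] that(3) by simp
    then obtain j where "j \<in> J" "x = j \<oplus>\<^bsub>P\<^esub> y" by (auto simp: a_r_coset_def')
    then show ?thesis using assms(5) that J.a_subset by auto
  qed
  show g: "g (J +>\<^bsub>P\<^esub> x) = h x" if "x \<in> carrier P" for x
  proof -
    define y where "y = (SOME y. y \<in> carrier P \<and> J +>\<^bsub>P\<^esub> x = J +>\<^bsub>P\<^esub> y)"
    have "y \<in> carrier P \<and> J +>\<^bsub>P\<^esub> x = J +>\<^bsub>P\<^esub> y"
      unfolding y_def by (rule someI[of _ x]) (use that in simp)
    then have "h x = h y" using that eq[of x y] by blast
    then show ?thesis unfolding g_def y_def by (rule sym)
  qed
  have repr: "\<exists>x\<in>carrier P. C = J +>\<^bsub>P\<^esub> x" if "C \<in> carrier (P Quot J)" for C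
    using that by (auto simp: FactRing_def A_RCOSETS_def')
  note p = J.rcos_ring_hom
  show "g \<in> ring_hom (P Quot J) S"
  proof (rule ring_hom_memI)
    fix C D assume "C \<in> carrier (P Quot J)" "D \<in> carrier (P Quot J)"
    then obtain x y where x: "x \<in> carrier P" "C = J +>\<^bsub>P\<^esub> x" and y: "y \<in> carrier P" "D = J +>\<^bsub>P\<^esub> y"
      using repr by blast
    show "g (C \<otimes>\<^bsub>P Quot J\<^esub> D) = g C \<otimes>\<^bsub>S\<^esub> g D" "g (C \<oplus>\<^bsub>P Quot J\<^esub> D) = g C \<oplus>\<^bsub>S\<^esub> g D"
      using x y by (simp_all add: ring_hom_mult[OF p, symmetric] ring_hom_add[OF p, symmetric] g)
  next
    fix C assume "C \<in> carrier (P Quot J)"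
    then show "g C \<in> carrier S" using repr g by fastforce
  next
    show "g \<one>\<^bsub>P Quot J\<^esub> = \<one>\<^bsub>S\<^esub>" by (simp add: ring_hom_one[OF p, symmetric] g)
  qed
qed

definition sym_var ::
  "('a, 'm) ring_scheme \<Rightarrow> ('a, 'c, 'n) module_scheme \<Rightarrow> 'c \<Rightarrow> ('c multiset \<Rightarrow> 'a) set"
where
  "sym_var R N x = sym_ideal R N +>\<^bsub>mpoly_ring R (carrier N)\<^esub> ring.indexed_var R x"

text \<open>The relations that define the symmetric algebra make sense as soon as sums and multiples of
  elements of \<open>N\<close> stay in \<open>N\<close>. The case of interest is the dual of a module.\<close>

locale symmetric_algebra = cring R for R :: "('a, 'm) ring_scheme" (structure) +
  fixes N :: "('a, 'c, 'n) module_scheme"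
  assumes add_closed: "x \<in> carrier N \<Longrightarrow> y \<in> carrier N \<Longrightarrow> x \<oplus>\<^bsub>N\<^esub> y \<in> carrier N"
    and smult_closed: "r \<in> carrier R \<Longrightarrow> x \<in> carrier N \<Longrightarrow> r \<odot>\<^bsub>N\<^esub> x \<in> carrier N"
begin

abbreviation "PN \<equiv> mpoly_ring R (carrier N)"
abbreviation "relations \<equiv>
  {indexed_var (x \<oplus>\<^bsub>N\<^esub> y) \<ominus>\<^bsub>PN\<^esub> (indexed_var x \<oplus>\<^bsub>PN\<^esub> indexed_var y) | x y. x \<in> carrier N \<and> y \<in> carrier N} \<union>
  {indexed_var (r \<odot>\<^bsub>N\<^esub> x) \<ominus>\<^bsub>PN\<^esub> (indexed_const r \<otimes>\<^bsub>PN\<^esub> indexed_var x) | r x. r \<in> carrier R \<and> x \<in> carrier N}"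

sublocale PN: cring PN by (rule cring_mpoly_ring)

lemma sym_ideal_eq: "sym_ideal R N = Idl\<^bsub>PN\<^esub> relations"
  by (simp add: sym_ideal_def Let_def)

lemma relations_carrier: "relations \<subseteq> carrier PN"
  by (auto intro!: PN.minus_closed PN.m_closed indexed_var_carrier indexed_const_carrier
      add_closed smult_closed)

sublocale J: ideal "sym_ideal R N" PN
  unfolding sym_ideal_eq by (rule PN.genideal_ideal[OF relations_carrier])

lemma cring_sym_algebra: "cring (sym_algebra R N)"
  unfolding sym_algebra_def by (rule J.quotient_is_cring[OF PN.is_cring])

lemma proj_ring_hom: "(+>\<^bsub>PN\<^esub>) (sym_ideal R N) \<in> ring_hom PN (sym_algebra R N)"
  unfolding sym_algebra_def by (rule J.rcos_ring_hom)

lemma sym_const_ring_hom: "sym_const R N \<in> ring_hom R (sym_algebra R N)"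
  using ring_hom_trans[OF indexed_const_ring_hom proj_ring_hom] by (simp add: sym_const_def[abs_def] o_def)

lemma sym_var_closed: "x \<in> carrier N \<Longrightarrow> sym_var R N x \<in> carrier (sym_algebra R N)"
  unfolding sym_var_def by (intro ring_hom_closed[OF proj_ring_hom] indexed_var_carrier)

lemma relation_mem: "z \<in> relations \<Longrightarrow> z \<in> sym_ideal R N"
  unfolding sym_ideal_eq using PN.genideal_self[OF relations_carrier] by blast

lemma sym_var_add:
  assumes "x \<in> carrier N" "y \<in> carrier N"
  shows "sym_var R N (x \<oplus>\<^bsub>N\<^esub> y) = sym_var R N x \<oplus>\<^bsub>sym_algebra R N\<^esub> sym_var R N y"
proof -
  have "sym_var R N (x \<oplus>\<^bsub>N\<^esub> y) = sym_ideal R N +>\<^bsub>PN\<^esub> (indexed_var x \<oplus>\<^bsub>PN\<^esub> indexed_var y)"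
    unfolding sym_var_def using assms
    by (intro coset_eq_if_minus_mem J.is_ideal relation_mem)
      (auto intro!: indexed_var_carrier add_closed)
  then show ?thesis using assms
    by (simp add: ring_hom_add[OF proj_ring_hom] indexed_var_carrier sym_var_def)
qed

lemma sym_var_smult:
  assumes "r \<in> carrier R" "x \<in> carrier N"
  shows "sym_var R N (r \<odot>\<^bsub>N\<^esub> x) = sym_const R N r \<otimes>\<^bsub>sym_algebra R N\<^esub> sym_var R N x"
proof -
  have "sym_var R N (r \<odot>\<^bsub>N\<^esub> x) = sym_ideal R N +>\<^bsub>PN\<^esub> (indexed_const r \<otimes>\<^bsub>PN\<^esub> indexed_var x)"
    unfolding sym_var_def using assms
    by (intro coset_eq_if_minus_mem J.is_ideal relation_mem)
      (auto intro!: indexed_var_carrier indexed_const_carrier smult_closed PN.m_closed)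
  then show ?thesis using assms
    by (simp add: ring_hom_mult[OF proj_ring_hom] indexed_var_carrier indexed_const_carrier
        sym_var_def sym_const_def)
qed

text \<open>Substitution of the values of \<open>u\<close> for the variables kills the defining relations, precisely
  because \<open>u\<close> is linear. This is the existence half of the universal property of \<open>Sym(N)\<close>.\<close>

theorem sym_algebra_lift:
  assumes S: "cring S" and \<rho>: "\<rho> \<in> ring_hom R S" and u: "u \<in> carrier N \<rightarrow> carrier S"
    and add: "\<And>x y. x \<in> carrier N \<Longrightarrow> y \<in> carrier N \<Longrightarrow> u (x \<oplus>\<^bsub>N\<^esub> y) = u x \<oplus>\<^bsub>S\<^esub> u y"
    and smult: "\<And>r x. r \<in> carrier R \<Longrightarrow> x \<in> carrier N \<Longrightarrow> u (r \<odot>\<^bsub>N\<^esub> x) = \<rho> r \<otimes>\<^bsub>S\<^esub> u x"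
  obtains g where "g \<in> ring_hom (sym_algebra R N) S"
    "\<And>r. r \<in> carrier R \<Longrightarrow> g (sym_const R N r) = \<rho> r"
    "\<And>x. x \<in> carrier N \<Longrightarrow> g (sym_var R N x) = u x"
proof -
  interpret S: cring S by fact
  interpret \<rho>: ring_hom_cring R S \<rho> by unfold_locales (rule \<rho>)
  define h where "h = mpoly_eval R S \<rho> u"
  have h: "h \<in> ring_hom PN S" unfolding h_def by (rule \<rho>.mpoly_eval_ring_hom[OF u])
  interpret h: ring_hom_ring PN S h by unfold_locales (rule h)
  have hc: "h (indexed_const r) = \<rho> r" if "r \<in> carrier R" for r
    unfolding h_def by (rule \<rho>.mpoly_eval_const[OF that])
  have hv: "h (indexed_var x) = u x" if "x \<in> carrier N" for x
    unfolding h_def using u that by (intro \<rho>.mpoly_eval_var) auto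
  have uc: "u x \<in> carrier S" if "x \<in> carrier N" for x using u that by auto
  have diff: "h (a \<ominus>\<^bsub>PN\<^esub> b) = \<zero>\<^bsub>S\<^esub>" if "a \<in> carrier PN" "b \<in> carrier PN" "h a = h b" for a b
    using that by (simp add: PN.minus_eq S.r_neg)
  have "h z = \<zero>\<^bsub>S\<^esub>" if z: "z \<in> relations" for z
    using z
  proof
    assume "z \<in> {indexed_var (x \<oplus>\<^bsub>N\<^esub> y) \<ominus>\<^bsub>PN\<^esub> (indexed_var x \<oplus>\<^bsub>PN\<^esub> indexed_var y) | x y.
      x \<in> carrier N \<and> y \<in> carrier N}"
    then obtain x y where "x \<in> carrier N" "y \<in> carrier N"
      "z = indexed_var (x \<oplus>\<^bsub>N\<^esub> y) \<ominus>\<^bsub>PN\<^esub> (indexed_var x \<oplus>\<^bsub>PN\<^esub> indexed_var y)" by blast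
    then show ?thesis
      using diff by (simp add: hv add add_closed indexed_var_carrier)
  next
    assume "z \<in> {indexed_var (r \<odot>\<^bsub>N\<^esub> x) \<ominus>\<^bsub>PN\<^esub> (indexed_const r \<otimes>\<^bsub>PN\<^esub> indexed_var x) | r x.
      r \<in> carrier R \<and> x \<in> carrier N}"
    then obtain r x where "r \<in> carrier R" "x \<in> carrier N"
      "z = indexed_var (r \<odot>\<^bsub>N\<^esub> x) \<ominus>\<^bsub>PN\<^esub> (indexed_const r \<otimes>\<^bsub>PN\<^esub> indexed_var x)" by blast
    then show ?thesis
      using diff by (simp add: hv hc smult smult_closed indexed_var_carrier indexed_const_carrier)
  qed
  then have "relations \<subseteq> a_kernel PN S h"
    using relations_carrier unfolding a_kernel_def' by blast
  then have "sym_ideal R N \<subseteq> a_kernel PN S h"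
    unfolding sym_ideal_eq by (rule PN.genideal_minimal[OF h.kernel_is_ideal])
  then have "h x = \<zero>\<^bsub>S\<^esub>" if "x \<in> sym_ideal R N" for x
    using that unfolding a_kernel_def' by blast
  then obtain g where g: "g \<in> ring_hom (PN Quot sym_ideal R N) S"
    "\<And>x. x \<in> carrier PN \<Longrightarrow> g (sym_ideal R N +>\<^bsub>PN\<^esub> x) = h x"
    using quotient_ring_lift[OF J.is_ideal PN.is_cring S h] by blast
  show ?thesis
  proof (rule that)
    show "g \<in> ring_hom (sym_algebra R N) S" using g(1) by (simp add: sym_algebra_def)
    show "g (sym_const R N r) = \<rho> r" if "r \<in> carrier R" for r
      using g(2)[OF indexed_const_carrier[OF that]] hc[OF that] by (simp only: sym_const_def)
    show "g (sym_var R N x) = u x" if "x \<in> carrier N" for x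
      using g(2)[OF indexed_var_carrier[OF that]] hv[OF that] by (simp only: sym_var_def)
  qed
qed

theorem sym_algebra_hom_unique:
  assumes S: "cring S" and f: "f \<in> ring_hom (sym_algebra R N) S" and g: "g \<in> ring_hom (sym_algebra R N) S"
    and const: "\<And>r. r \<in> carrier R \<Longrightarrow> f (sym_const R N r) = g (sym_const R N r)"
    and var: "\<And>x. x \<in> carrier N \<Longrightarrow> f (sym_var R N x) = g (sym_var R N x)"
    and a: "a \<in> carrier (sym_algebra R N)"
  shows "f a = g a"
proof -
  let ?p = "(+>\<^bsub>PN\<^esub>) (sym_ideal R N)"
  obtain F where F: "F \<in> carrier PN" "a = ?p F"
    using a by (auto simp: sym_algebra_def FactRing_def A_RCOSETS_def')
  note fp = ring_hom_trans[OF proj_ring_hom f] and gp = ring_hom_trans[OF proj_ring_hom g]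
  have fv: "(\<lambda>x. f (sym_var R N x)) \<in> carrier N \<rightarrow> carrier S"
    using ring_hom_closed[OF f] sym_var_closed by auto
  note sc = ring_hom_trans[OF sym_const_ring_hom f]
  have "(f \<circ> ?p) F = mpoly_eval R S (\<lambda>r. f (sym_const R N r)) (\<lambda>x. f (sym_var R N x)) F"
    by (subst mpoly_hom_eq_eval[OF is_cring S fp F(1)]) (simp add: sym_const_def sym_var_def)
  also have "\<dots> = mpoly_eval R S (\<lambda>r. g (sym_const R N r)) (\<lambda>x. g (sym_var R N x)) F"
    using sc by (intro mpoly_eval_cong[OF F(1) S _ fv] const var) (simp add: o_def)
  also have "\<dots> = (g \<circ> ?p) F"
    by (subst mpoly_hom_eq_eval[OF is_cring S gp F(1)]) (simp add: sym_const_def sym_var_def)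
  finally show ?thesis by (simp add: F)
qed

end

section \<open>The coordinate ring of a projective module is a retract of a polynomial ring\<close>

lemma linear_mapsD:
  assumes "f \<in> linear_maps R M N"
  shows "x \<in> carrier M \<Longrightarrow> f x \<in> carrier N"
    "x \<in> carrier M \<Longrightarrow> y \<in> carrier M \<Longrightarrow> f (x \<oplus>\<^bsub>M\<^esub> y) = f x \<oplus>\<^bsub>N\<^esub> f y"
    "r \<in> carrier R \<Longrightarrow> x \<in> carrier M \<Longrightarrow> f (r \<odot>\<^bsub>M\<^esub> x) = r \<odot>\<^bsub>N\<^esub> f x"
  using assms by (auto simp: linear_maps_def)

lemma dual_carrier_iff:
  "f \<in> carrier (dual_module R M) \<longleftrightarrow> f \<in> carrier M \<rightarrow> carrier R \<and> f \<in> extensional (carrier M) \<and>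
     (\<forall>x\<in>carrier M. \<forall>y\<in>carrier M. f (x \<oplus>\<^bsub>M\<^esub> y) = f x \<oplus>\<^bsub>R\<^esub> f y) \<and>
     (\<forall>r\<in>carrier R. \<forall>x\<in>carrier M. f (r \<odot>\<^bsub>M\<^esub> x) = r \<otimes>\<^bsub>R\<^esub> f x)"
  by (auto simp: dual_module_def linear_maps_def regular_module_def)

lemma dual_ops:
  "f \<oplus>\<^bsub>dual_module R M\<^esub> g = (\<lambda>x\<in>carrier M. f x \<oplus>\<^bsub>R\<^esub> g x)"
  "r \<odot>\<^bsub>dual_module R M\<^esub> f = (\<lambda>x\<in>carrier M. r \<otimes>\<^bsub>R\<^esub> f x)"
  by (simp_all add: dual_module_def)

lemma free_ops:
  "carrier (free_module R n) = {..<n} \<rightarrow>\<^sub>E carrier R"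
  "x \<oplus>\<^bsub>free_module R n\<^esub> y = (\<lambda>i\<in>{..<n}. x i \<oplus>\<^bsub>R\<^esub> y i)"
  "r \<odot>\<^bsub>free_module R n\<^esub> x = (\<lambda>i\<in>{..<n}. r \<otimes>\<^bsub>R\<^esub> x i)"
  by (simp_all add: free_module_def)

lemma (in module) symmetric_algebra_dual: "symmetric_algebra R (dual_module R M)"
proof
  fix f g assume "f \<in> carrier (dual_module R M)" "g \<in> carrier (dual_module R M)"
  then have "f x \<in> carrier R" "g x \<in> carrier R" "f (x \<oplus>\<^bsub>M\<^esub> y) = f x \<oplus> f y" "g (x \<oplus>\<^bsub>M\<^esub> y) = g x \<oplus> g y"
    "r \<in> carrier R \<Longrightarrow> f (r \<odot>\<^bsub>M\<^esub> x) = r \<otimes> f x" "r \<in> carrier R \<Longrightarrow> g (r \<odot>\<^bsub>M\<^esub> x) = r \<otimes> g x"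
    if "x \<in> carrier M" "y \<in> carrier M" for x y r
    using that by (auto simp: dual_carrier_iff)
  then show "f \<oplus>\<^bsub>dual_module R M\<^esub> g \<in> carrier (dual_module R M)"
    unfolding dual_carrier_iff dual_ops by (auto simp: R.r_distr R.add.m_ac)
next
  fix r f assume "r \<in> carrier R" "f \<in> carrier (dual_module R M)"
  then have "r \<in> carrier R" "f x \<in> carrier R" "f (x \<oplus>\<^bsub>M\<^esub> y) = f x \<oplus> f y"
    "s \<in> carrier R \<Longrightarrow> f (s \<odot>\<^bsub>M\<^esub> x) = s \<otimes> f x"
    if "x \<in> carrier M" "y \<in> carrier M" for x y s
    using that by (auto simp: dual_carrier_iff)
  then show "r \<odot>\<^bsub>dual_module R M\<^esub> f \<in> carrier (dual_module R M)"
    unfolding dual_carrier_iff dual_ops by (auto simp: R.r_distr R.m_ac \<open>r \<in> carrier R\<close>)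
qed

text \<open>The proof truncates \<open>y\<close> to its first \<open>k\<close> coordinates and adds one multiple of a standard basis
  vector at a time.\<close>

lemma (in cring) linear_on_free_module:
  assumes add: "\<And>x y. x \<in> carrier (free_module R n) \<Longrightarrow> y \<in> carrier (free_module R n) \<Longrightarrow>
      \<mu> (x \<oplus>\<^bsub>free_module R n\<^esub> y) = \<mu> x \<oplus> \<mu> y"
    and smult: "\<And>r x. r \<in> carrier R \<Longrightarrow> x \<in> carrier (free_module R n) \<Longrightarrow>
      \<mu> (r \<odot>\<^bsub>free_module R n\<^esub> x) = r \<otimes> \<mu> x"
    and closed: "\<And>x. x \<in> carrier (free_module R n) \<Longrightarrow> \<mu> x \<in> carrier R"
    and y: "y \<in> carrier (free_module R n)"
  shows "\<mu> y = (\<Oplus>i\<in>{..<n}. \<mu> (\<lambda>j\<in>{..<n}. if j = i then \<one> else \<zero>) \<otimes> y i)"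
proof -
  let ?F = "free_module R n"
  define e where "e i = (\<lambda>j\<in>{..<n}. if j = i then \<one> else \<zero>)" for i
  define t where "t k = (\<lambda>j\<in>{..<n}. if j < k then y j else \<zero>)" for k :: nat
  have yc: "y i \<in> carrier R" if "i < n" for i using y that by (auto simp: free_ops)
  have e: "e i \<in> carrier ?F" for i by (auto simp: e_def free_ops)
  have t: "t k \<in> carrier ?F" for k using yc by (auto simp: t_def free_ops)
  have "k \<le> n \<Longrightarrow> \<mu> (t k) = (\<Oplus>i\<in>{..<k}. \<mu> (e i) \<otimes> y i)" for k
  proof (induction k)
    case 0
    have "\<zero> \<odot>\<^bsub>?F\<^esub> t 0 = t 0" by (auto simp: free_ops t_def)
    then have "\<mu> (t 0) = \<zero> \<otimes> \<mu> (t 0)" using smult[OF zero_closed t, of 0] by simp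
    then show ?case using closed[OF t] by simp
  next
    case (Suc k)
    have "t (Suc k) = t k \<oplus>\<^bsub>?F\<^esub> (y k \<odot>\<^bsub>?F\<^esub> e k)"
    proof
      fix j
      show "t (Suc k) j = (t k \<oplus>\<^bsub>?F\<^esub> (y k \<odot>\<^bsub>?F\<^esub> e k)) j"
        using Suc.prems yc[of j] yc[of k] by (cases j k rule: linorder_cases) (auto simp: t_def e_def free_ops)
    qed
    moreover have "y k \<odot>\<^bsub>?F\<^esub> e k \<in> carrier ?F" using Suc.prems yc e by (auto simp: free_ops e_def)
    ultimately have "\<mu> (t (Suc k)) = \<mu> (t k) \<oplus> y k \<otimes> \<mu> (e k)"
      using Suc.prems add[OF t] smult[OF yc e] by simp
    also have "\<dots> = \<mu> (e k) \<otimes> y k \<oplus> (\<Oplus>i\<in>{..<k}. \<mu> (e i) \<otimes> y i)"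
      using Suc yc closed[OF e] closed[OF t] by (simp add: m_comm a_comm)
    also have "\<dots> = (\<Oplus>i\<in>{..<Suc k}. \<mu> (e i) \<otimes> y i)"
      unfolding lessThan_Suc using Suc.prems yc closed[OF e]
      by (subst finsum_insert) auto
    finally show ?case .
  qed
  then have "\<mu> (t n) = (\<Oplus>i\<in>{..<n}. \<mu> (e i) \<otimes> y i)" by simp
  moreover have "t n = y" using y by (auto simp: t_def free_ops fun_eq_iff PiE_def extensional_def)
  ultimately show ?thesis by (simp add: e_def)
qed

text \<open>Linear combinations in \<open>M\<^sup>*\<close> are written pointwise, with sums in \<open>R\<close>. The claim then follows
  from the defining relations of \<open>Sym(M\<^sup>*)\<close> by adding one term at a time.\<close>

lemma (in module) sym_var_linear_combination:
  fixes c :: "nat \<Rightarrow> 'c \<Rightarrow> 'a"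
  assumes c: "\<And>i. i < n \<Longrightarrow> c i \<in> carrier (dual_module R M)" and r: "\<And>i. i < n \<Longrightarrow> r i \<in> carrier R"
  shows "sym_var R (dual_module R M) (\<lambda>x\<in>carrier M. \<Oplus>\<^bsub>R\<^esub>i\<in>{..<n}. r i \<otimes> c i x) =
    (\<Oplus>\<^bsub>W_ring R M\<^esub>i\<in>{..<n}. W_const R M (r i) \<otimes>\<^bsub>W_ring R M\<^esub> sym_var R (dual_module R M) (c i))"
proof -
  let ?N = "dual_module R M"
  interpret N: symmetric_algebra R ?N by (rule symmetric_algebra_dual)
  interpret W: cring "W_ring R M" unfolding W_ring_def by (rule N.cring_sym_algebra)
  define L where "L k = (\<lambda>x\<in>carrier M. \<Oplus>\<^bsub>R\<^esub>i\<in>{..<k}. r i \<otimes> c i x)" for k :: nat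
  have cx: "c i x \<in> carrier R" if "i < n" "x \<in> carrier M" for i x
    using c[OF that(1)] that(2) by (auto simp: dual_carrier_iff)
  have cW: "sym_var R ?N (c i) \<in> carrier (W_ring R M)" if "i < n" for i
    using N.sym_var_closed[OF c[OF that]] by (simp add: W_ring_def)
  have rW: "W_const R M (r i) \<in> carrier (W_ring R M)" if "i < n" for i
    using ring_hom_closed[OF N.sym_const_ring_hom r[OF that]] by (simp add: W_ring_def W_const_def)
  have "k \<le> n \<Longrightarrow> L k \<in> carrier ?N \<and> sym_var R ?N (L k) =
    (\<Oplus>\<^bsub>W_ring R M\<^esub>i\<in>{..<k}. W_const R M (r i) \<otimes>\<^bsub>W_ring R M\<^esub> sym_var R ?N (c i))" for k
  proof (induction k)
    case 0
    have L0: "L 0 \<in> carrier ?N" by (auto simp: L_def dual_carrier_iff)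
    have "\<zero> \<odot>\<^bsub>?N\<^esub> L 0 = L 0" by (auto simp: dual_ops L_def fun_eq_iff)
    then have "sym_var R ?N (L 0) = sym_const R ?N \<zero> \<otimes>\<^bsub>sym_algebra R ?N\<^esub> sym_var R ?N (L 0)"
      using N.sym_var_smult[OF R.zero_closed L0] by simp
    also have "sym_const R ?N \<zero> = \<zero>\<^bsub>sym_algebra R ?N\<^esub>"
      using N.sym_const_ring_hom N.cring_sym_algebra
      by (intro ring_hom_zero R.ring_axioms) (auto simp: cring_def)
    also have "\<zero>\<^bsub>sym_algebra R ?N\<^esub> \<otimes>\<^bsub>sym_algebra R ?N\<^esub> sym_var R ?N (L 0) = \<zero>\<^bsub>W_ring R M\<^esub>"
      using W.l_null N.sym_var_closed[OF L0] by (simp add: W_ring_def)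
    finally show ?case using L0 by simp
  next
    case (Suc k)
    then have k: "k < n" and Lk: "L k \<in> carrier ?N" and IH: "sym_var R ?N (L k) =
      (\<Oplus>\<^bsub>W_ring R M\<^esub>i\<in>{..<k}. W_const R M (r i) \<otimes>\<^bsub>W_ring R M\<^esub> sym_var R ?N (c i))" by auto
    have "L (Suc k) x = (r k \<odot>\<^bsub>?N\<^esub> c k \<oplus>\<^bsub>?N\<^esub> L k) x" for x
    proof (cases "x \<in> carrier M")
      case True
      have "(\<Oplus>\<^bsub>R\<^esub>i\<in>{..<Suc k}. r i \<otimes> c i x) = r k \<otimes> c k x \<oplus> (\<Oplus>\<^bsub>R\<^esub>i\<in>{..<k}. r i \<otimes> c i x)"
        unfolding lessThan_Suc using k r cx True by (intro R.finsum_insert) auto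
      then show ?thesis using True by (simp add: L_def dual_ops)
    qed (simp add: L_def dual_ops)
    then have L: "L (Suc k) = r k \<odot>\<^bsub>?N\<^esub> c k \<oplus>\<^bsub>?N\<^esub> L k" ..
    have "sym_var R ?N (L (Suc k)) = W_const R M (r k) \<otimes>\<^bsub>W_ring R M\<^esub> sym_var R ?N (c k)
        \<oplus>\<^bsub>W_ring R M\<^esub> sym_var R ?N (L k)"
      unfolding L W_ring_def W_const_def using c[OF k] r[OF k] Lk
      by (simp add: N.sym_var_add N.sym_var_smult N.smult_closed)
    also have "\<dots> = W_const R M (r k) \<otimes>\<^bsub>W_ring R M\<^esub> sym_var R ?N (c k) \<oplus>\<^bsub>W_ring R M\<^esub>
        (\<Oplus>\<^bsub>W_ring R M\<^esub>i\<in>{..<k}. W_const R M (r i) \<otimes>\<^bsub>W_ring R M\<^esub> sym_var R ?N (c i))"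
      by (simp only: IH)
    also have "\<dots> = (\<Oplus>\<^bsub>W_ring R M\<^esub>i\<in>{..<Suc k}. W_const R M (r i) \<otimes>\<^bsub>W_ring R M\<^esub> sym_var R ?N (c i))"
      unfolding lessThan_Suc using k rW cW by (intro W.finsum_insert[symmetric]) auto
    finally show ?case using c[OF k] r[OF k] Lk by (simp add: L N.add_closed N.smult_closed)
  qed
  then show ?thesis by (simp add: L_def)
qed

text \<open>\<open>M\<close> is a direct summand of \<open>R\<^sup>n\<close>, by an inclusion \<open>\<iota>\<close> and a projection \<open>\<pi>\<close>. By functoriality
  \<open>W(M)\<close> is a retract of affine \<open>n\<close>-space, that is, its coordinate ring is a retract of the
  polynomial ring. Explicitly, \<open>\<tau>\<close> sends a linear form \<open>l\<close> to the linear polynomial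
  \<open>\<Sum>\<^sub>i l(\<pi> e\<^sub>i) X\<^sub>i\<close>, and \<open>\<theta>\<close> sends \<open>X\<^sub>i\<close> to the \<open>i\<close>-th coordinate of \<open>\<iota>\<close>. The composition is the
  identity because \<open>l = l \<circ> \<pi> \<circ> \<iota>\<close>.\<close>

theorem W_ring_retract_of_mpoly_ring:
  assumes "fin_gen_projective R M"
  obtains \<tau> and n :: nat and \<theta> where
    "\<tau> \<in> ring_hom (W_ring R M) (mpoly_ring R {1..n})"
    "\<theta> \<in> ring_hom (mpoly_ring R {1..n}) (W_ring R M)"
    "\<And>r. r \<in> carrier R \<Longrightarrow> \<tau> (W_const R M r) = ring.indexed_const R r"
    "\<And>r. r \<in> carrier R \<Longrightarrow> \<theta> (ring.indexed_const R r) = W_const R M r"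
    "\<And>a. a \<in> carrier (W_ring R M) \<Longrightarrow> \<theta> (\<tau> a) = a"
proof -
  note [simp del] = One_nat_def
  obtain n \<iota> \<pi> where M: "module R M" and \<iota>: "\<iota> \<in> linear_maps R M (free_module R n)"
    and \<pi>: "\<pi> \<in> linear_maps R (free_module R n) M" and \<pi>\<iota>: "\<And>x. x \<in> carrier M \<Longrightarrow> \<pi> (\<iota> x) = x"
    using assms by (auto simp: fin_gen_projective_def)
  interpret M: module R M by (rule M)
  let ?N = "dual_module R M" and ?P = "mpoly_ring R {1..n}" and ?F = "free_module R n"
  interpret N: symmetric_algebra R ?N by (rule M.symmetric_algebra_dual)
  interpret W: cring "W_ring R M" unfolding W_ring_def by (rule N.cring_sym_algebra)
  interpret P: cring ?P by (rule M.R.cring_mpoly_ring)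
  interpret \<kappa>: ring_hom_cring R "W_ring R M" "W_const R M"
    by unfold_locales (simp add: W_ring_def W_const_def N.sym_const_ring_hom)
  interpret C: ring_hom_cring R ?P M.R.indexed_const
    by unfold_locales (rule M.R.indexed_const_ring_hom)
  define e where "e i = (\<lambda>j\<in>{..<n}. if j = i then \<one>\<^bsub>R\<^esub> else \<zero>\<^bsub>R\<^esub>)" for i
  define c where "c i = (\<lambda>x\<in>carrier M. \<iota> x i)" for i
  have e: "e i \<in> carrier ?F" for i by (auto simp: e_def free_ops)
  note \<iota> = linear_mapsD[OF \<iota>] and \<pi> = linear_mapsD[OF \<pi>]
  have c: "c i \<in> carrier ?N" if "i < n" for i
    unfolding dual_carrier_iff using \<iota> that by (auto simp: c_def free_ops)
  have dual: "l x \<in> carrier R" "l (x \<oplus>\<^bsub>M\<^esub> y) = l x \<oplus>\<^bsub>R\<^esub> l y" "r \<in> carrier R \<Longrightarrow> l (r \<odot>\<^bsub>M\<^esub> x) = r \<otimes>\<^bsub>R\<^esub> l x"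
    if "l \<in> carrier ?N" "x \<in> carrier M" "y \<in> carrier M" for l x y r
    using that by (auto simp: dual_carrier_iff)
  have l\<pi>: "l (\<pi> (e i)) \<in> carrier R" if "l \<in> carrier ?N" for l i
    using dual(1)[OF that] \<pi>(1)[OF e] by blast
  have basis: "l = (\<lambda>x\<in>carrier M. \<Oplus>\<^bsub>R\<^esub>i\<in>{..<n}. l (\<pi> (e i)) \<otimes>\<^bsub>R\<^esub> c i x)" if l: "l \<in> carrier ?N" for l
  proof
    fix x
    show "l x = (\<lambda>x\<in>carrier M. \<Oplus>\<^bsub>R\<^esub>i\<in>{..<n}. l (\<pi> (e i)) \<otimes>\<^bsub>R\<^esub> c i x) x"
    proof (cases "x \<in> carrier M")
      case True
      have "(l \<circ> \<pi>) (\<iota> x) = (\<Oplus>\<^bsub>R\<^esub>i\<in>{..<n}. (l \<circ> \<pi>) (\<lambda>j\<in>{..<n}. if j = i then \<one>\<^bsub>R\<^esub> else \<zero>\<^bsub>R\<^esub>) \<otimes>\<^bsub>R\<^esub> \<iota> x i)"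
        by (rule M.R.linear_on_free_module) (use True l \<pi> \<iota> dual in auto)
      then show ?thesis using True by (simp add: \<pi>\<iota> c_def e_def)
    qed (use l in \<open>auto simp: dual_carrier_iff extensional_def\<close>)
  qed
  \<comment> \<open>The coordinates of \<open>R\<^sup>n\<close> are numbered from \<open>0\<close>, the variables from \<open>1\<close>.\<close>
  define u where "u l = (\<Oplus>\<^bsub>?P\<^esub>i\<in>{..<n}. M.R.indexed_const (l (\<pi> (e i))) \<otimes>\<^bsub>?P\<^esub> M.R.indexed_var (Suc i))" for l
  have v: "M.R.indexed_var (Suc i) \<in> carrier ?P" if "i < n" for i
    using that by (intro M.R.indexed_var_carrier) auto
  have uc: "u l \<in> carrier ?P" if "l \<in> carrier ?N" for l
    unfolding u_def using v l\<pi>[OF that] by (intro P.finsum_closed) (auto intro!: P.m_closed)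
  have u_add: "u (l \<oplus>\<^bsub>?N\<^esub> l') = u l \<oplus>\<^bsub>?P\<^esub> u l'" if "l \<in> carrier ?N" "l' \<in> carrier ?N" for l l'
  proof -
    have "u (l \<oplus>\<^bsub>?N\<^esub> l') = (\<Oplus>\<^bsub>?P\<^esub>i\<in>{..<n}.
      M.R.indexed_const (l (\<pi> (e i))) \<otimes>\<^bsub>?P\<^esub> M.R.indexed_var (Suc i) \<oplus>\<^bsub>?P\<^esub>
      M.R.indexed_const (l' (\<pi> (e i))) \<otimes>\<^bsub>?P\<^esub> M.R.indexed_var (Suc i))"
      unfolding u_def using v l\<pi>[OF that(1)] l\<pi>[OF that(2)] \<pi>(1)[OF e]
      by (intro P.finsum_cong') (auto simp: dual_ops P.l_distr intro!: P.m_closed)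
    also have "\<dots> = u l \<oplus>\<^bsub>?P\<^esub> u l'"
      unfolding u_def using v l\<pi>[OF that(1)] l\<pi>[OF that(2)]
      by (intro P.finsum_addf) (auto intro!: P.m_closed)
    finally show ?thesis .
  qed
  have u_smult: "u (r \<odot>\<^bsub>?N\<^esub> l) = M.R.indexed_const r \<otimes>\<^bsub>?P\<^esub> u l" if "r \<in> carrier R" "l \<in> carrier ?N" for r l
  proof -
    have "u (r \<odot>\<^bsub>?N\<^esub> l) = (\<Oplus>\<^bsub>?P\<^esub>i\<in>{..<n}. M.R.indexed_const r \<otimes>\<^bsub>?P\<^esub>
      (M.R.indexed_const (l (\<pi> (e i))) \<otimes>\<^bsub>?P\<^esub> M.R.indexed_var (Suc i)))"
      unfolding u_def using v that l\<pi>[OF that(2)] \<pi>(1)[OF e]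
      by (intro P.finsum_cong') (auto simp: dual_ops P.m_assoc intro!: P.m_closed)
    also have "\<dots> = M.R.indexed_const r \<otimes>\<^bsub>?P\<^esub> u l"
      unfolding u_def using v that l\<pi>[OF that(2)]
      by (intro P.finsum_rdistr[symmetric]) (auto intro!: P.m_closed)
    finally show ?thesis .
  qed
  obtain \<tau> where \<tau>: "\<tau> \<in> ring_hom (sym_algebra R ?N) ?P"
    "\<And>r. r \<in> carrier R \<Longrightarrow> \<tau> (sym_const R ?N r) = M.R.indexed_const r"
    "\<And>l. l \<in> carrier ?N \<Longrightarrow> \<tau> (sym_var R ?N l) = u l"
    using N.sym_algebra_lift[OF P.is_cring M.R.indexed_const_ring_hom _ u_add u_smult] uc by blast
  define s where "s j = sym_var R ?N (c (j - 1))" for j :: nat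
  have s: "s \<in> {1..n} \<rightarrow> carrier (W_ring R M)"
    unfolding s_def W_ring_def by (auto intro!: N.sym_var_closed c)
  define \<theta> where "\<theta> = mpoly_eval R (W_ring R M) (W_const R M) s"
  have \<theta>: "\<theta> \<in> ring_hom ?P (W_ring R M)" unfolding \<theta>_def by (rule \<kappa>.mpoly_eval_ring_hom[OF s])
  interpret \<theta>: ring_hom_cring ?P "W_ring R M" \<theta> by unfold_locales (rule \<theta>)
  have \<theta>c: "\<theta> (M.R.indexed_const r) = W_const R M r" if "r \<in> carrier R" for r
    unfolding \<theta>_def by (rule \<kappa>.mpoly_eval_const[OF that])
  have \<theta>v: "\<theta> (M.R.indexed_var (Suc i)) = sym_var R ?N (c i)" if "i < n" for i
  proof -
    have "s (Suc i) \<in> carrier (W_ring R M)" using s that by auto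
    then show ?thesis unfolding \<theta>_def by (subst \<kappa>.mpoly_eval_var) (simp_all add: s_def)
  qed
  have \<theta>u: "\<theta> (u l) = sym_var R ?N l" if l: "l \<in> carrier ?N" for l
  proof -
    have "\<theta> (u l) = (\<Oplus>\<^bsub>W_ring R M\<^esub>i\<in>{..<n}. (\<theta> \<circ> (\<lambda>i. M.R.indexed_const (l (\<pi> (e i))) \<otimes>\<^bsub>?P\<^esub> M.R.indexed_var (Suc i))) i)"
      unfolding u_def using v l\<pi>[OF l] by (intro \<theta>.hom_finsum) (auto intro!: P.m_closed)
    also have "\<dots> = (\<Oplus>\<^bsub>W_ring R M\<^esub>i\<in>{..<n}. W_const R M (l (\<pi> (e i))) \<otimes>\<^bsub>W_ring R M\<^esub> sym_var R ?N (c i))"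
      using v l\<pi>[OF l] N.sym_var_closed[OF c]
      by (intro W.finsum_cong') (auto simp: \<theta>c \<theta>v W_ring_def[symmetric] intro!: W.m_closed)
    also have "\<dots> = sym_var R ?N l"
      using M.sym_var_linear_combination[of n c "\<lambda>i. l (\<pi> (e i))"] c l\<pi>[OF l] basis[OF l] by simp
    finally show ?thesis .
  qed
  have \<theta>\<tau>: "(\<theta> \<circ> \<tau>) a = id a" if "a \<in> carrier (W_ring R M)" for a
  proof (rule N.sym_algebra_hom_unique[OF W.is_cring[unfolded W_ring_def],
        where f = "\<theta> \<circ> \<tau>" and g = id])
    show "\<theta> \<circ> \<tau> \<in> ring_hom (sym_algebra R ?N) (sym_algebra R ?N)"
      using ring_hom_trans[OF \<tau>(1) \<theta>] by (simp add: W_ring_def)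
    show "(\<theta> \<circ> \<tau>) (sym_const R ?N r) = id (sym_const R ?N r)" if "r \<in> carrier R" for r
      using \<theta>c[OF that] \<tau>(2)[OF that] by (simp add: W_const_def)
    show "(\<theta> \<circ> \<tau>) (sym_var R ?N l) = id (sym_var R ?N l)" if "l \<in> carrier ?N" for l
      using \<theta>u[OF that] \<tau>(3)[OF that] by simp
    show "a \<in> carrier (sym_algebra R ?N)" using that by (simp add: W_ring_def)
  qed simp
  show ?thesis
  proof (rule that)
    show "\<tau> \<in> ring_hom (W_ring R M) ?P" using \<tau>(1) by (simp add: W_ring_def)
    show "\<theta> \<in> ring_hom ?P (W_ring R M)" by (rule \<theta>)
    show "\<tau> (W_const R M r) = M.R.indexed_const r" if "r \<in> carrier R" for r
      using \<tau>(2)[OF that] by (simp add: W_const_def)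
    show "\<theta> (M.R.indexed_const r) = W_const R M r" if "r \<in> carrier R" for r
      by (rule \<theta>c[OF that])
    show "\<theta> (\<tau> a) = a" if "a \<in> carrier (W_ring R M)" for a using \<theta>\<tau>[OF that] by simp
  qed
qed

section \<open>Quasi-compact open subsets of a spectrum\<close>

lemma topspace_Spec: "topspace (Spec A) = {\<qq>. primeideal \<qq> A}"
proof -
  have "\<exists>f\<in>carrier A. f \<notin> \<qq>" if q: "primeideal \<qq> A" for \<qq>
  proof -
    interpret primeideal \<qq> A by fact
    show ?thesis using I_notcarr a_subset by blast
  qed
  then show ?thesis unfolding Spec_def by auto
qed

text \<open>The principal open sets generate the topology, and by primality the intersection of two of
  them is again principal. So they form a basis.\<close>

lemma Spec_basis:
  assumes "cring A" "openin (Spec A) U" "\<pp> \<in> U"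
  shows "\<exists>f\<in>carrier A. f \<notin> \<pp> \<and> {\<qq>. primeideal \<qq> A \<and> f \<notin> \<qq>} \<subseteq> U"
proof -
  have "generate_topology_on ((\<lambda>f. {\<qq>. primeideal \<qq> A \<and> f \<notin> \<qq>}) ` carrier A) U"
    using assms(2) unfolding Spec_def openin_topology_generated_by_iff .
  then show ?thesis using assms(3)
  proof (induction)
    case (Int U V)
    then obtain f g where f: "f \<in> carrier A" "f \<notin> \<pp>" "{\<qq>. primeideal \<qq> A \<and> f \<notin> \<qq>} \<subseteq> U"
      and g: "g \<in> carrier A" "g \<notin> \<pp>" "{\<qq>. primeideal \<qq> A \<and> g \<notin> \<qq>} \<subseteq> V" by auto
    have "\<pp> \<in> topspace (Spec A)" using openin_subset[OF assms(2)] assms(3) by blast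
    then interpret p: primeideal \<pp> A by (simp add: topspace_Spec)
    have "f \<notin> \<qq> \<and> g \<notin> \<qq>" if "primeideal \<qq> A" "f \<otimes>\<^bsub>A\<^esub> g \<notin> \<qq>" for \<qq>
    proof -
      interpret q: primeideal \<qq> A by fact
      show ?thesis using that(2) f(1) g(1) q.I_l_closed q.I_r_closed by blast
    qed
    moreover have "f \<otimes>\<^bsub>A\<^esub> g \<notin> \<pp>" using f g p.I_prime by blast
    ultimately show ?case using f g by (intro bexI[of _ "f \<otimes>\<^bsub>A\<^esub> g"]) auto
  qed (blast+)
qed

theorem quasi_compact_open_in_Spec:
  assumes "cring A" "openin (Spec A) U" "compactin (Spec A) U"
  obtains B where "finite B" "B \<subseteq> carrier A" "U = {\<qq>. primeideal \<qq> A \<and> (\<exists>f\<in>B. f \<notin> \<qq>)}"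
proof -
  let ?D = "\<lambda>f. {\<qq>. primeideal \<qq> A \<and> f \<notin> \<qq>}"
  define G where "G = {f\<in>carrier A. ?D f \<subseteq> U}"
  have U: "U \<subseteq> {\<qq>. primeideal \<qq> A}" using openin_subset[OF assms(2)] by (simp add: topspace_Spec)
  have "openin (Spec A) V" if "V \<in> ?D ` G" for V
    unfolding Spec_def by (rule topology_generated_by_Basis) (use that in \<open>auto simp: G_def\<close>)
  moreover have "U \<subseteq> \<Union>(?D ` G)"
    using Spec_basis[OF assms(1,2)] U unfolding G_def by blast
  ultimately obtain \<F> where \<F>: "finite \<F>" "\<F> \<subseteq> ?D ` G" "U \<subseteq> \<Union>\<F>"
    using compactinD[OF assms(3), of "?D ` G"] by meson
  obtain B where B: "B \<subseteq> G" "finite B" "\<F> = ?D ` B"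
    using finite_subset_image[OF \<F>(1,2)] by blast
  have cover: "U \<subseteq> \<Union>(?D ` B)" using \<F>(3) unfolding B(3) .
  show ?thesis
  proof (rule that)
    show "U = {\<qq>. primeideal \<qq> A \<and> (\<exists>f\<in>B. f \<notin> \<qq>)}" 
      using B(1) cover unfolding G_def by blast
  qed (use B in \<open>auto simp: G_def\<close>)
qed


section \<open>Polynomials whose unit values give points of an open subset\<close>

lemma ideal_finsum_mem:
  assumes "ideal I R" "\<And>a. a \<in> A \<Longrightarrow> f a \<in> I"
  shows "(\<Oplus>\<^bsub>R\<^esub>a\<in>A. f a) \<in> I"
proof -
  interpret ideal I R by fact
  show ?thesis using assms(2)
  proof (induction A rule: infinite_finite_induct)
    case (insert a A)
    have "f a \<in> carrier R" "f \<in> A \<rightarrow> carrier R" using insert a_subset by auto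
    then show ?case using insert by (simp add: a_closed)
  qed auto
qed

lemma primeideal_unit_notin:
  assumes "primeideal \<qq> T" "u \<in> Units T" shows "u \<notin> \<qq>"
proof
  interpret primeideal \<qq> T by fact
  assume "u \<in> \<qq>"
  moreover obtain v where "v \<in> carrier T" "v \<otimes>\<^bsub>T\<^esub> u = \<one>\<^bsub>T\<^esub>" using assms(2) by (auto simp: Units_def)
  ultimately have "\<one>\<^bsub>T\<^esub> \<in> \<qq>" using I_l_closed by metis
  then show False using one_imp_carrier I_notcarr by blast
qed

text \<open>The case of interest has fresh variables \<open>y j\<close> as indeterminate coefficients of the \<open>p j\<close>.\<close>

lemma (in ring_hom_cring) mpoly_eval_combination:
  assumes y: "\<And>j. j \<in> J \<Longrightarrow> y j \<in> I" and p: "\<And>j. j \<in> J \<Longrightarrow> p j \<in> carrier (mpoly_ring R I)"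
    and s: "s \<in> I \<rightarrow> carrier S"
  shows "mpoly_eval R S h s (\<Oplus>\<^bsub>mpoly_ring R I\<^esub>j\<in>J. R.indexed_var (y j) \<otimes>\<^bsub>mpoly_ring R I\<^esub> p j) =
    (\<Oplus>\<^bsub>S\<^esub>j\<in>J. s (y j) \<otimes>\<^bsub>S\<^esub> mpoly_eval R S h s (p j))"
proof -
  let ?P = "mpoly_ring R I"
  interpret P: cring ?P by (rule R.cring_mpoly_ring)
  interpret ev: ring_hom_cring ?P S "mpoly_eval R S h s"
    by unfold_locales (rule mpoly_eval_ring_hom[OF s])
  have v: "mpoly_eval R S h s (R.indexed_var (y j)) = s (y j)" "s (y j) \<in> carrier S"
    "R.indexed_var (y j) \<in> carrier ?P" if "j \<in> J" for j
    using s y[OF that] by (auto intro!: mpoly_eval_var R.indexed_var_carrier)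
  have "mpoly_eval R S h s (\<Oplus>\<^bsub>?P\<^esub>j\<in>J. R.indexed_var (y j) \<otimes>\<^bsub>?P\<^esub> p j) =
      (\<Oplus>\<^bsub>S\<^esub>j\<in>J. (mpoly_eval R S h s \<circ> (\<lambda>j. R.indexed_var (y j) \<otimes>\<^bsub>?P\<^esub> p j)) j)"
    using v p by (intro ev.hom_finsum) (auto intro!: P.m_closed)
  also have "\<dots> = (\<Oplus>\<^bsub>S\<^esub>j\<in>J. s (y j) \<otimes>\<^bsub>S\<^esub> mpoly_eval R S h s (p j))"
    using v p by (intro S.finsum_cong') (auto intro!: S.m_closed)
  finally show ?thesis .
qed

text \<open>For \<open>B = {f\<^sub>1, \<dots>, f\<^sub>k}\<close> take \<open>F = \<Sum>\<^sub>j Y\<^sub>j \<tau>(f\<^sub>j)\<close> with new variables \<open>Y\<^sub>j = X\<^bsub>n+j\<^esub>\<close>. A value of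
  \<open>F\<close> lies in the ideal generated by the values of the \<open>\<tau>(f\<^sub>j)\<close>; if it is a unit, no prime ideal
  contains all of these, and the first \<open>n\<close> coordinates define a point of the open set where some
  \<open>f\<^sub>j\<close> does not vanish. Conversely, each \<open>f\<^sub>j\<close> is itself a value of \<open>F\<close> over \<open>A\<close>, so that whatever
  a homomorphism from \<open>A\<close> does to \<open>f\<^sub>j\<close> is seen by \<open>F\<close>.\<close>

theorem unit_polynomial_for_open:
  assumes R: "cring R" and A: "cring A" and \<tau>: "\<tau> \<in> ring_hom A (mpoly_ring R {1..n::nat})"
    and \<theta>: "\<theta> \<in> ring_hom (mpoly_ring R {1..n}) A"
    and \<kappa>: "\<And>r. r \<in> carrier R \<Longrightarrow> \<theta> (ring.indexed_const R r) = \<kappa> r" "\<kappa> \<in> ring_hom R A"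
    and \<theta>\<tau>: "\<And>a. a \<in> carrier A \<Longrightarrow> \<theta> (\<tau> a) = a"
    and B: "finite B" "B \<subseteq> carrier A"
  obtains N F where "n \<le> N" "F \<in> carrier (mpoly_ring R {1..N})"
    "\<And>s \<qq>. s \<in> {1..N} \<rightarrow> carrier R \<Longrightarrow> mpoly_eval R R (\<lambda>r. r) s F \<in> Units R \<Longrightarrow> primeideal \<qq> R \<Longrightarrow>
      \<exists>f\<in>B. mpoly_eval R R (\<lambda>r. r) s (\<tau> f) \<notin> \<qq>"
    "\<And>f. f \<in> B \<Longrightarrow> \<exists>s \<in> {1..N} \<rightarrow> carrier A. mpoly_eval R A \<kappa> s F = f"
proof -
  note [simp del] = One_nat_def
  obtain g where g: "bij_betw g {..<card B} B"
    using ex_bij_betw_nat_finite[OF B(1)] by (auto simp: atLeast0LessThan)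
  define k where "k = card B"
  define N where "N = n + k"
  let ?P = "mpoly_ring R {1..N}"
  interpret R: cring R by fact
  interpret A: cring A by fact
  interpret P: cring ?P by (rule R.cring_mpoly_ring)
  have gB: "g j \<in> B" if "j < k" for j using g that by (auto simp: bij_betw_def k_def)
  define y where "y j = n + 1 + j" for j :: nat
  have yN: "y j \<in> {1..N}" if "j < k" for j using that by (auto simp: y_def N_def)
  have \<tau>c: "\<tau> f \<in> carrier (mpoly_ring R {1..n})" if "f \<in> B" for f
    using ring_hom_closed[OF \<tau>] B that by blast
  then have \<tau>N: "\<tau> f \<in> carrier ?P" if "f \<in> B" for f
    using that by (rule_tac mpoly_carrier_mono[of "{1..n}"]) (auto simp: N_def)
  define F where "F = (\<Oplus>\<^bsub>?P\<^esub>j\<in>{..<k}. R.indexed_var (y j) \<otimes>\<^bsub>?P\<^esub> \<tau> (g j))"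
  have Fj: "R.indexed_var (y j) \<otimes>\<^bsub>?P\<^esub> \<tau> (g j) \<in> carrier ?P" if "j < k" for j
    by (intro P.m_closed R.indexed_var_carrier yN \<tau>N gB that)
  have F: "F \<in> carrier ?P" unfolding F_def using Fj by (intro P.finsum_closed) auto
  have gA: "g j \<in> carrier A" if "j < k" for j using gB[OF that] B(2) by blast
  interpret id: ring_hom_cring R R "\<lambda>r. r" by unfold_locales (auto intro: ring_hom_memI)
  interpret \<kappa>: ring_hom_cring R A \<kappa> by unfold_locales (rule \<kappa>)
  have eval_id: "mpoly_eval R R (\<lambda>r. r) s F =
      (\<Oplus>\<^bsub>R\<^esub>j\<in>{..<k}. s (y j) \<otimes>\<^bsub>R\<^esub> mpoly_eval R R (\<lambda>r. r) s (\<tau> (g j)))"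
    if "s \<in> {1..N} \<rightarrow> carrier R" for s
    unfolding F_def using yN \<tau>N gB that by (intro id.mpoly_eval_combination) auto
  have eval_\<kappa>: "mpoly_eval R A \<kappa> s F = (\<Oplus>\<^bsub>A\<^esub>j\<in>{..<k}. s (y j) \<otimes>\<^bsub>A\<^esub> mpoly_eval R A \<kappa> s (\<tau> (g j)))"
    if "s \<in> {1..N} \<rightarrow> carrier A" for s
    unfolding F_def using yN \<tau>N gB that by (intro \<kappa>.mpoly_eval_combination) auto
  show ?thesis
  proof (rule that[of N F])
    show "n \<le> N" by (simp add: N_def)
    show "F \<in> carrier ?P" by (rule F)
    show "\<exists>f\<in>B. mpoly_eval R R (\<lambda>r. r) s (\<tau> f) \<notin> \<qq>"
      if s: "s \<in> {1..N} \<rightarrow> carrier R" and u: "mpoly_eval R R (\<lambda>r. r) s F \<in> Units R"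
        and q: "primeideal \<qq> R" for s \<qq>
    proof (rule ccontr)
      assume "\<not> (\<exists>f\<in>B. mpoly_eval R R (\<lambda>r. r) s (\<tau> f) \<notin> \<qq>)"
      then have "mpoly_eval R R (\<lambda>r. r) s F \<in> \<qq>"
        unfolding eval_id[OF s] using s yN gB primeideal.axioms(1)[OF q]
        by (intro ideal_finsum_mem) (auto intro!: ideal.I_l_closed)
      then show False using primeideal_unit_notin[OF q u] by blast
    qed
    show "\<exists>s \<in> {1..N} \<rightarrow> carrier A. mpoly_eval R A \<kappa> s F = f" if "f \<in> B" for f
    proof -
      have "f \<in> g ` {..<k}" using g \<open>f \<in> B\<close> by (simp add: bij_betw_def k_def)
      then obtain j0 where j0: "j0 < k" "g j0 = f" by auto
      \<comment> \<open>The universal point of \<open>Spec A\<close>, with a \<open>1\<close> in the slot of \<open>Y\<close> that selects \<open>f\<close>.\<close>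
      define s where "s i = (if i \<le> n then \<theta> (R.indexed_var i) else if i = y j0 then \<one>\<^bsub>A\<^esub> else \<zero>\<^bsub>A\<^esub>)" for i
      have s1: "s \<in> {1..n} \<rightarrow> carrier A"
        by (auto simp: s_def intro!: ring_hom_closed[OF \<theta>] R.indexed_var_carrier)
      then have s: "s \<in> {1..N} \<rightarrow> carrier A" by (auto simp: s_def Pi_iff)
      have ev: "mpoly_eval R A \<kappa> s (\<tau> (g j)) = g j" if "j < k" for j
      proof -
        have "\<theta> (\<tau> (g j)) = mpoly_eval R A (\<lambda>r. \<theta> (R.indexed_const r)) (\<lambda>i. \<theta> (R.indexed_var i)) (\<tau> (g j))"
          by (rule mpoly_hom_eq_eval[OF R A \<theta> \<tau>c[OF gB[OF that]]])
        also have "\<dots> = mpoly_eval R A \<kappa> s (\<tau> (g j))"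
          by (rule mpoly_eval_cong[OF \<tau>c[OF gB[OF that]] A \<kappa>(2) s1, symmetric])
            (auto simp: s_def \<kappa>)
        finally show ?thesis using \<theta>\<tau> B gB[OF that] by auto
      qed
      have "mpoly_eval R A \<kappa> s F = (\<Oplus>\<^bsub>A\<^esub>j\<in>{..<k}. if j = j0 then g j else \<zero>\<^bsub>A\<^esub>)"
        unfolding eval_\<kappa>[OF s]
      proof (rule A.finsum_cong')
        fix j assume j: "j \<in> {..<k}"
        have "g j \<in> carrier A" using gA j by auto
        then show "s (y j) \<otimes>\<^bsub>A\<^esub> mpoly_eval R A \<kappa> s (\<tau> (g j)) = (if j = j0 then g j else \<zero>\<^bsub>A\<^esub>)"
          using ev j by (auto simp: s_def y_def)
      qed (use gA in auto)
      also have "\<dots> = f" using gA j0 by (subst A.add.finprod_singleton_swap) auto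
      finally show ?thesis using s by blast
    qed
  qed
qed

section \<open>The primitive criterion in several variables\<close>

lemma digits_eqI:
  fixes f g :: "nat \<Rightarrow> nat"
  assumes "\<And>i. i < n \<Longrightarrow> f i < b" "\<And>i. i < n \<Longrightarrow> g i < b"
    and "(\<Sum>i<n. f i * b ^ i) = (\<Sum>i<n. g i * b ^ i)" and "i < n"
  shows "f i = g i"
  using assms
proof (induction n arbitrary: f g i)
  case (Suc n)
  have split: "(\<Sum>i<Suc n. h i * b ^ i) = h 0 + b * (\<Sum>i<n. h (Suc i) * b ^ i)" for h :: "nat \<Rightarrow> nat"
    by (subst sum.lessThan_Suc_shift) (simp add: sum_distrib_left mult_ac)
  have "b > 0" using Suc.prems(1)[of 0] by simp
  have e: "f 0 + b * (\<Sum>i<n. f (Suc i) * b ^ i) = g 0 + b * (\<Sum>i<n. g (Suc i) * b ^ i)"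
    using Suc.prems(3) unfolding split .
  then have "f 0 mod b = g 0 mod b" by (metis mod_mult_self2)
  then have 0: "f 0 = g 0" using Suc.prems(1,2)[of 0] by simp
  then have "(\<Sum>i<n. f (Suc i) * b ^ i) = (\<Sum>i<n. g (Suc i) * b ^ i)" using e \<open>b > 0\<close> by simp
  then have "f (Suc j) = g (Suc j)" if "j < n" for j
    using Suc.IH[of "\<lambda>i. f (Suc i)" "\<lambda>i. g (Suc i)" j] Suc.prems(1,2) that by auto
  then show ?case using 0 Suc.prems(4) by (cases i) auto
qed simp

lemma sum_mset_eq_sum_count:
  fixes w :: "'i \<Rightarrow> nat"
  assumes "finite A" "set_mset m \<subseteq> A"
  shows "(\<Sum>i\<in>#m. w i) = (\<Sum>i\<in>A. count m i * w i)"
  using assms(2)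
proof (induction m)
  case (add x m)
  have "(\<Sum>i\<in>A. count (add_mset x m) i * w i) = (\<Sum>i\<in>A. count m i * w i + (if i = x then w x else 0))"
    by (intro sum.cong) auto
  then show ?case using add assms(1) by (simp add: sum.distrib)
qed simp

text \<open>Finitely many monomials become powers of a single variable with pairwise distinct exponents
  under \<open>X\<^sub>i \<mapsto> T\<^bsup>w i\<^esup>\<close> with \<open>w i = b\<^sup>i\<close>, if \<open>b\<close> exceeds all their exponents: these are then the
  digits in base \<open>b\<close>. The base chosen below exceeds even the sum of the total degrees.\<close>

lemma exists_separating_weights:
  fixes A :: "nat multiset set"
  assumes "finite A" "\<And>m i. m \<in> A \<Longrightarrow> i \<in># m \<Longrightarrow> i < n"
  obtains w :: "nat \<Rightarrow> nat" where "inj_on (\<lambda>m. \<Sum>i\<in>#m. w i) A"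
proof -
  define b where "b = Suc (\<Sum>m\<in>A. size m)"
  have b: "count m i < b" if "m \<in> A" for m i
  proof -
    have "count m i \<le> size m" by (rule count_le_size)
    also have "\<dots> \<le> (\<Sum>m\<in>A. size m)" using assms(1) that by (intro member_le_sum) auto
    finally show ?thesis by (simp add: b_def)
  qed
  show ?thesis
  proof (rule that, rule inj_onI)
    fix m m' assume m: "m \<in> A" "m' \<in> A" "(\<Sum>i\<in>#m. b ^ i) = (\<Sum>i\<in>#m'. b ^ i)"
    have sub: "set_mset m \<subseteq> {..<n}" "set_mset m' \<subseteq> {..<n}" using assms(2) m by auto
    then have "(\<Sum>i<n. count m i * b ^ i) = (\<Sum>i<n. count m' i * b ^ i)"
      using m(3) by (simp add: sum_mset_eq_sum_count[of "{..<n}"])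
    then have "count m i = count m' i" if "i < n" for i
      using digits_eqI[of n "count m" b "count m'"] b m that by blast
    moreover have "count m i = count m' i" if "\<not> i < n" for i
      using sub that by (metis lessThan_iff not_in_iff subsetD)
    ultimately show "m = m'" by (intro multiset_eqI) blast
  qed
qed

lemma (in UP_cring) monomial_value_UP:
  "monomial_value P (\<lambda>i. up_ring.monom P \<one> (w i)) m = up_ring.monom P \<one> (\<Sum>i\<in>#m. w i)"
proof (induction m)
  case empty
  show ?case by simp
next
  case (add i m)
  have "monomial_value P (\<lambda>i. up_ring.monom P \<one> (w i)) (m + {#i#}) =
      monomial_value P (\<lambda>i. up_ring.monom P \<one> (w i)) m \<otimes>\<^bsub>P\<^esub> monomial_value P (\<lambda>i. up_ring.monom P \<one> (w i)) {#i#}"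
    by (rule P.monomial_value_add) simp
  also have "\<dots> = up_ring.monom P \<one> (\<Sum>i\<in>#m. w i) \<otimes>\<^bsub>P\<^esub> up_ring.monom P \<one> (w i)"
    using add by (simp add: P.monomial_value_single)
  also have "\<dots> = up_ring.monom P (\<one> \<otimes> \<one>) ((\<Sum>i\<in>#m. w i) + w i)"
    by (rule monom_mult[symmetric]) auto
  finally show ?case by (simp add: add.commute)
qed

text \<open>Kronecker substitution turns \<open>F\<close> into a polynomial \<open>G\<close> in one variable that has the same
  nonzero coefficients as \<open>F\<close>, hence is primitive if \<open>F\<close> is. If \<open>G(t)\<close> is a unit, then so is
  the value of \<open>F\<close> at the corresponding powers of \<open>t\<close>. Separation of the exponents prevents
  cancellation among the coefficients.\<close>

theorem primitive_criterion_multivariate: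
  assumes R: "cring R" and pc: "primitive_criterion R" and F: "F \<in> carrier (mpoly_ring R {1..N::nat})"
    and prim: "Idl\<^bsub>R\<^esub> (range F) = carrier R"
  obtains s where "s \<in> {1..N} \<rightarrow> carrier R" "mpoly_eval R R (\<lambda>r. r) s F \<in> Units R"
proof -
  interpret UP_cring R "UP R" by (intro UP_cring.intro R) simp
  note Fc = mpoly_carrierD[OF F]
  obtain w :: "nat \<Rightarrow> nat" where w: "inj_on (\<lambda>m. \<Sum>i\<in>#m. w i) {m. F m \<noteq> \<zero>\<^bsub>R\<^esub>}"
    using exists_separating_weights[of "{m. F m \<noteq> \<zero>\<^bsub>R\<^esub>}" "Suc N"] Fc by (auto simp: less_Suc_eq_le)
  let ?c = "\<lambda>r. up_ring.monom (UP R) r 0" and ?x = "\<lambda>i. up_ring.monom (UP R) \<one>\<^bsub>R\<^esub> (w i)"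
  interpret c: ring_hom_cring R "UP R" ?c by unfold_locales (rule const_ring_hom)
  define G where "G = mpoly_eval R (UP R) ?c ?x F"
  have x: "?x \<in> {1..N} \<rightarrow> carrier (UP R)" by auto
  have Gc: "G \<in> carrier (UP R)" unfolding G_def by (rule c.mpoly_eval_closed[OF F x])
  have G: "G = (\<Oplus>\<^bsub>UP R\<^esub>m\<in>{m. F m \<noteq> \<zero>\<^bsub>R\<^esub>}. up_ring.monom (UP R) (F m) (\<Sum>i\<in>#m. w i))"
    unfolding G_def mpoly_eval_alt monomial_value_UP
  proof (rule P.finsum_cong')
    fix m
    show "up_ring.monom (UP R) (F m) 0 \<otimes>\<^bsub>UP R\<^esub> up_ring.monom (UP R) \<one>\<^bsub>R\<^esub> (\<Sum>i\<in>#m. w i) = up_ring.monom (UP R) (F m) (\<Sum>i\<in>#m. w i)"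
      using monom_mult[of "F m" "\<one>\<^bsub>R\<^esub>" 0 "\<Sum>i\<in>#m. w i"] Fc(1) by simp
  qed (use Fc in auto)
  have coeffG: "up_ring.coeff (UP R) G (\<Sum>i\<in>#m. w i) = F m" if m: "F m \<noteq> \<zero>\<^bsub>R\<^esub>" for m
  proof -
    have "up_ring.coeff (UP R) G (\<Sum>i\<in>#m. w i) =
        (\<Oplus>\<^bsub>R\<^esub>m'\<in>{m. F m \<noteq> \<zero>\<^bsub>R\<^esub>}. up_ring.coeff (UP R) (up_ring.monom (UP R) (F m') (\<Sum>i\<in>#m'. w i)) (\<Sum>i\<in>#m. w i))"
      unfolding G using Fc by (intro coeff_finsum) auto
    also have "\<dots> = (\<Oplus>\<^bsub>R\<^esub>m'\<in>{m. F m \<noteq> \<zero>\<^bsub>R\<^esub>}. if m' = m then F m' else \<zero>\<^bsub>R\<^esub>)"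
      using Fc(1) inj_onD[OF w] m by (intro R.finsum_cong') auto
    also have "\<dots> = F m" using Fc m by (subst R.add.finprod_singleton_swap) auto
    finally show ?thesis .
  qed
  have I: "ideal (Idl\<^bsub>R\<^esub> (range (up_ring.coeff (UP R) G))) R"
    using Gc by (intro R.genideal_ideal) auto
  have "carrier R \<subseteq> Idl\<^bsub>R\<^esub> (range (up_ring.coeff (UP R) G))"
  proof -
    have "F m \<in> Idl\<^bsub>R\<^esub> (range (up_ring.coeff (UP R) G))" for m
    proof (cases "F m = \<zero>\<^bsub>R\<^esub>")
      case True
      then show ?thesis using additive_subgroup.zero_closed[OF ideal.axioms(1)[OF I]] by simp
    next
      case False
      have "range (up_ring.coeff (UP R) G) \<subseteq> Idl\<^bsub>R\<^esub> (range (up_ring.coeff (UP R) G))"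
        using Gc by (intro R.genideal_self) auto
      then show ?thesis using coeffG[OF False] by (metis rangeI subsetD)
    qed
    then show ?thesis unfolding prim[symmetric] using I by (intro R.genideal_minimal) auto
  qed
  then have "Idl\<^bsub>R\<^esub> (range (up_ring.coeff (UP R) G)) = carrier R"
    using ideal.Icarr[OF I] by blast
  then have "primitive_poly R G" using Gc by (simp add: primitive_poly_def)
  then obtain t where t: "t \<in> carrier R" and unit: "UnivPoly.eval R R (\<lambda>x. x) t G \<in> Units R"
    using pc by (auto simp: primitive_criterion_def)
  have id: "(\<lambda>x. x) \<in> ring_hom R R" by (rule ring_hom_memI) simp_all
  note ev = UP_pre_univ_propI[OF R R id]
  interpret h: ring_hom_cring "UP R" R "UnivPoly.eval R R (\<lambda>x. x) t"
    by unfold_locales (rule UP_pre_univ_prop.eval_ring_hom[OF ev t])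
  have "UnivPoly.eval R R (\<lambda>x. x) t G =
      mpoly_eval R R (UnivPoly.eval R R (\<lambda>x. x) t \<circ> ?c) (UnivPoly.eval R R (\<lambda>x. x) t \<circ> ?x) F"
    unfolding G_def by (rule hom_mpoly_eval[OF c.ring_hom_cring_axioms h.ring_hom_cring_axioms F x])
  also have "\<dots> = mpoly_eval R R (\<lambda>r. r) (\<lambda>i. t [^]\<^bsub>R\<^esub> w i) F"
  proof (rule mpoly_eval_cong[OF F R, symmetric])
    show "(\<lambda>r. r) \<in> ring_hom R R" by (rule id)
    show "(\<lambda>i. t [^]\<^bsub>R\<^esub> w i) \<in> {1..N} \<rightarrow> carrier R" using t by simp
    show "r = (UnivPoly.eval R R (\<lambda>x. x) t \<circ> ?c) r" if "r \<in> carrier R" for r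
      using UP_pre_univ_prop.eval_const[OF ev t that] by simp
    show "t [^]\<^bsub>R\<^esub> w i = (UnivPoly.eval R R (\<lambda>x. x) t \<circ> ?x) i" for i
      using UP_pre_univ_prop.eval_monom[OF ev R.one_closed t, of "w i"] t by simp
  qed
  finally have "mpoly_eval R R (\<lambda>r. r) (\<lambda>i. t [^]\<^bsub>R\<^esub> w i) F \<in> Units R" using unit by simp
  moreover have "(\<lambda>i. t [^]\<^bsub>R\<^esub> w i) \<in> {1..N} \<rightarrow> carrier R" using t by auto
  ultimately show ?thesis using that by blast
qed

section \<open>Points of open subschemes\<close>

lemma (in cring) exists_maximalideal_containing:
  assumes I: "ideal I R" and proper: "I \<noteq> carrier R"
  obtains \<mm> where "maximalideal \<mm> R" "I \<subseteq> \<mm>"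
proof -
  define \<A> where "\<A> = {J. ideal J R \<and> I \<subseteq> J \<and> \<one> \<notin> J}"
  have IA: "I \<in> \<A>" using I proper ideal.one_imp_carrier by (auto simp: \<A>_def)
  have "\<exists>m\<in>\<A>. \<forall>J\<in>\<A>. m \<subseteq> J \<longrightarrow> J = m"
  proof (rule subset_Zorn)
    fix C assume C: "subset.chain \<A> C"
    show "\<exists>K\<in>\<A>. \<forall>J\<in>C. J \<subseteq> K"
    proof (cases "C = {}")
      case False
      have "subset.chain {J. ideal J R} C" using C by (auto simp: pred_on.chain_def \<A>_def)
      then have "ideal (\<Union>C) R" using chain_Union_is_ideal[of C] False by simp
      moreover have "I \<subseteq> \<Union>C" "\<one> \<notin> \<Union>C"
        using C False unfolding pred_on.chain_def \<A>_def by blast+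
      ultimately show ?thesis by (intro bexI[of _ "\<Union>C"]) (auto simp: \<A>_def)
    qed (use IA in auto)
  qed
  then obtain m where m: "m \<in> \<A>" "\<And>J. J \<in> \<A> \<Longrightarrow> m \<subseteq> J \<Longrightarrow> J = m" by blast
  show ?thesis
  proof (rule that)
    show "maximalideal m R"
    proof (rule maximalidealI)
      show "ideal m R" "carrier R \<noteq> m" using m(1) by (auto simp: \<A>_def)
      fix J assume J: "ideal J R" "m \<subseteq> J" "J \<subseteq> carrier R"
      show "J = m \<or> J = carrier R"
      proof (cases "\<one> \<in> J")
        case True
        then show ?thesis using ideal.one_imp_carrier[OF J(1)] by simp
      next
        case False
        then have "J \<in> \<A>" using J m(1) by (auto simp: \<A>_def)
        then show ?thesis using m(2) J(2) by blast
      qed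
    qed
    show "I \<subseteq> m" using m(1) by (simp add: \<A>_def)
  qed
qed

text \<open>The preimage of a prime ideal under \<open>\<phi>\<close> is again prime, so that its membership in \<open>U\<close> only
  depends on which elements of \<open>B\<close> it contains.\<close>

lemma W_points_iff:
  assumes W: "cring (W_ring R M)" and T: "cring T"
    and B: "B \<subseteq> carrier (W_ring R M)" "U = {\<qq>. primeideal \<qq> (W_ring R M) \<and> (\<exists>f\<in>B. f \<notin> \<qq>)}"
  shows "\<phi> \<in> W_points R M U T \<rho> \<longleftrightarrow>
    \<phi> \<in> ring_hom (W_ring R M) T \<and> \<phi> \<in> extensional (carrier (W_ring R M)) \<and>
    (\<forall>r\<in>carrier R. \<phi> (W_const R M r) = \<rho> r) \<and> (\<forall>\<qq>. primeideal \<qq> T \<longrightarrow> (\<exists>f\<in>B. \<phi> f \<notin> \<qq>))"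
proof -
  have "{a \<in> carrier (W_ring R M). \<phi> a \<in> \<qq>} \<in> U \<longleftrightarrow> (\<exists>f\<in>B. \<phi> f \<notin> \<qq>)"
    if "\<phi> \<in> ring_hom (W_ring R M) T" "primeideal \<qq> T" for \<qq>
  proof -
    have "primeideal {a \<in> carrier (W_ring R M). \<phi> a \<in> \<qq>} (W_ring R M)"
      using W T that by (intro ring_hom_ring.primeideal_vimage ring_hom_ringI2) (auto simp: cring_def)
    then show ?thesis using B by auto
  qed
  then show ?thesis by (auto simp: W_points_def)
qed

lemma W_points_nonemptyI:
  assumes W: "cring (W_ring R M)" and T: "cring T"
    and B: "B \<subseteq> carrier (W_ring R M)" "U = {\<qq>. primeideal \<qq> (W_ring R M) \<and> (\<exists>f\<in>B. f \<notin> \<qq>)}"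
    and \<kappa>: "W_const R M \<in> ring_hom R (W_ring R M)"
    and \<phi>: "\<phi> \<in> ring_hom (W_ring R M) T" "\<And>r. r \<in> carrier R \<Longrightarrow> \<phi> (W_const R M r) = \<rho> r"
      "\<And>\<qq>. primeideal \<qq> T \<Longrightarrow> \<exists>f\<in>B. \<phi> f \<notin> \<qq>"
  shows "W_points R M U T \<rho> \<noteq> {}"
proof -
  let ?\<phi> = "restrict \<phi> (carrier (W_ring R M))"
  have "?\<phi> \<in> ring_hom (W_ring R M) T"
    by (rule ring.ring_hom_restrict[OF _ \<phi>(1)]) (use W in \<open>auto simp: cring_def\<close>)
  moreover have "?\<phi> f = \<phi> f" if "f \<in> B" for f using that B by auto
  moreover have "?\<phi> (W_const R M r) = \<rho> r" if "r \<in> carrier R" for r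
    using \<phi>(2)[OF that] ring_hom_closed[OF \<kappa> that] by simp
  ultimately have "?\<phi> \<in> W_points R M U T \<rho>"
    unfolding W_points_iff[OF W T B] using \<phi>(3) by auto
  then show ?thesis by blast
qed

theorem proposition1p4:
  fixes R :: "('a, 'm) ring_scheme"
    and M :: "('a, 'b, 'n) module_scheme"
    and U :: "(('b \<Rightarrow> 'a) multiset \<Rightarrow> 'a) set set set"
  assumes "LG_ring R"
    and "fin_gen_projective R M"
    and "openin (Spec (W_ring R M)) U"
    and "compactin (Spec (W_ring R M)) U"
  shows "(W_points R M U R (\<lambda>r. r) \<noteq> {} \<longleftrightarrow>
          (\<forall>\<mm>. maximalideal \<mm> R \<longrightarrow> W_points R M U (R Quot \<mm>) (a_r_coset R \<mm>) \<noteq> {})) \<and>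
         (primitive_criterion R \<longrightarrow> R_dense R M U \<longrightarrow> W_points R M U R (\<lambda>r. r) \<noteq> {})"
proof -
  let ?W = "W_ring R M" and ?\<kappa> = "W_const R M"
  have R: "cring R" using assms(1) by (simp add: LG_ring_def)
  interpret R: cring R by (rule R)
  have M: "module R M" using assms(2) by (simp add: fin_gen_projective_def)
  interpret N: symmetric_algebra R "dual_module R M" by (rule module.symmetric_algebra_dual[OF M])
  have W: "cring ?W" unfolding W_ring_def by (rule N.cring_sym_algebra)
  have \<kappa>: "?\<kappa> \<in> ring_hom R ?W" unfolding W_ring_def W_const_def by (rule N.sym_const_ring_hom)
  obtain \<tau> and n :: nat and \<theta> where \<tau>: "\<tau> \<in> ring_hom ?W (mpoly_ring R {1..n})"
    and \<theta>: "\<theta> \<in> ring_hom (mpoly_ring R {1..n}) ?W"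
    and \<tau>\<kappa>: "\<And>r. r \<in> carrier R \<Longrightarrow> \<tau> (?\<kappa> r) = R.indexed_const r"
    and \<theta>\<kappa>: "\<And>r. r \<in> carrier R \<Longrightarrow> \<theta> (R.indexed_const r) = ?\<kappa> r"
    and \<theta>\<tau>: "\<And>a. a \<in> carrier ?W \<Longrightarrow> \<theta> (\<tau> a) = a"
    using that by (rule W_ring_retract_of_mpoly_ring[OF assms(2)])
  obtain B where B: "finite B" "B \<subseteq> carrier ?W" "U = {\<qq>. primeideal \<qq> ?W \<and> (\<exists>f\<in>B. f \<notin> \<qq>)}"
    using that by (rule quasi_compact_open_in_Spec[OF W assms(3,4)])
  obtain N F where N: "n \<le> N" and F: "F \<in> carrier (mpoly_ring R {1..N})"
    and unit: "\<And>s \<qq>. s \<in> {1..N} \<rightarrow> carrier R \<Longrightarrow> mpoly_eval R R (\<lambda>r. r) s F \<in> Units R \<Longrightarrow>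
      primeideal \<qq> R \<Longrightarrow> \<exists>f\<in>B. mpoly_eval R R (\<lambda>r. r) s (\<tau> f) \<notin> \<qq>"
    and value_at: "\<And>f. f \<in> B \<Longrightarrow> \<exists>s \<in> {1..N} \<rightarrow> carrier ?W. mpoly_eval R ?W ?\<kappa> s F = f"
    using unit_polynomial_for_open[OF R W \<tau> \<theta> \<theta>\<kappa> \<kappa> \<theta>\<tau> B(1,2)] by blast
  have id: "(\<lambda>r. r) \<in> ring_hom R R" by (rule ring_hom_memI) simp_all
  have idR: "ring_hom_cring R R (\<lambda>r. r)"
    using R id by (intro ring_hom_cring.intro ring_hom_cring_axioms.intro)
  have section_hom: "mpoly_eval R R (\<lambda>r. r) s \<circ> \<tau> \<in> ring_hom ?W R"
    "r \<in> carrier R \<Longrightarrow> (mpoly_eval R R (\<lambda>r. r) s \<circ> \<tau>) (?\<kappa> r) = r"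
    if "s \<in> {1..n} \<rightarrow> carrier R" for s r
    using ring_hom_trans[OF \<tau> ring_hom_cring.mpoly_eval_ring_hom[OF idR that]]
      ring_hom_cring.mpoly_eval_const[OF idR, of r s] \<tau>\<kappa>[of r] by auto
  \<comment> \<open>Both parts of the theorem construct their point of \<open>U\<close> from a unit value of \<open>F\<close>.\<close>
  have point: "W_points R M U R (\<lambda>r. r) \<noteq> {}"
    if s: "s \<in> {1..N} \<rightarrow> carrier R" "mpoly_eval R R (\<lambda>r. r) s F \<in> Units R" for s
  proof (rule W_points_nonemptyI[OF W R B(2,3) \<kappa>])
    have s': "s \<in> {1..n} \<rightarrow> carrier R" using s(1) N by auto
    show "mpoly_eval R R (\<lambda>r. r) s \<circ> \<tau> \<in> ring_hom ?W R" by (rule section_hom(1)[OF s'])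
    show "(mpoly_eval R R (\<lambda>r. r) s \<circ> \<tau>) (?\<kappa> r) = r" if "r \<in> carrier R" for r
      by (rule section_hom(2)[OF s' that])
    show "\<exists>f\<in>B. (mpoly_eval R R (\<lambda>r. r) s \<circ> \<tau>) f \<notin> \<qq>" if "primeideal \<qq> R" for \<qq>
      using unit[OF s that] by simp
  qed
  have a1: "W_points R M U (R Quot \<mm>) (a_r_coset R \<mm>) \<noteq> {}"
    if \<mm>: "maximalideal \<mm> R" and ne: "W_points R M U R (\<lambda>r. r) \<noteq> {}" for \<mm>
  proof -
    interpret \<mm>: maximalideal \<mm> R by fact
    let ?p = "a_r_coset R \<mm>"
    have Q: "cring (R Quot \<mm>)" by (rule \<mm>.quotient_is_cring[OF R])
    have p: "?p \<in> ring_hom R (R Quot \<mm>)" by (rule \<mm>.rcos_ring_hom)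
    obtain \<phi> where \<phi>: "\<phi> \<in> ring_hom ?W R" "\<And>r. r \<in> carrier R \<Longrightarrow> \<phi> (?\<kappa> r) = r"
      "\<And>\<qq>. primeideal \<qq> R \<Longrightarrow> \<exists>f\<in>B. \<phi> f \<notin> \<qq>"
      using ne unfolding ex_in_conv[symmetric] W_points_iff[OF W R B(2,3)] by metis
    show ?thesis
    proof (rule W_points_nonemptyI[OF W Q B(2,3) \<kappa>])
      show "?p \<circ> \<phi> \<in> ring_hom ?W (R Quot \<mm>)" by (rule ring_hom_trans[OF \<phi>(1) p])
      show "(?p \<circ> \<phi>) (?\<kappa> r) = ?p r" if "r \<in> carrier R" for r using \<phi>(2)[OF that] by simp
      show "\<exists>f\<in>B. (?p \<circ> \<phi>) f \<notin> \<qq>" if "primeideal \<qq> (R Quot \<mm>)" for \<qq>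
      proof -
        have "primeideal {r \<in> carrier R. ?p r \<in> \<qq>} R"
          by (rule ring_hom_ring.primeideal_vimage[OF \<mm>.rcos_ring_hom_ring R that])
        then obtain f where f: "f \<in> B" "\<phi> f \<notin> {r \<in> carrier R. ?p r \<in> \<qq>}" using \<phi>(3) by blast
        moreover have "\<phi> f \<in> carrier R" using ring_hom_closed[OF \<phi>(1)] f(1) B(2) by blast
        ultimately show ?thesis by auto
      qed
    qed
  qed
  have a2: "W_points R M U R (\<lambda>r. r) \<noteq> {}"
    if fibres: "\<And>\<mm>. maximalideal \<mm> R \<Longrightarrow> W_points R M U (R Quot \<mm>) (a_r_coset R \<mm>) \<noteq> {}"
  proof -
    have "represents_unit R (R Quot \<mm>) (a_r_coset R \<mm>) {1..N} F" if \<mm>: "maximalideal \<mm> R" for \<mm>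
    proof -
      interpret \<mm>: maximalideal \<mm> R by fact
      let ?k = "R Quot \<mm>" and ?p = "a_r_coset R \<mm>"
      have p: "?p \<in> ring_hom R ?k" by (rule \<mm>.rcos_ring_hom)
      interpret k: field ?k by (rule \<mm>.quotient_is_field[OF R])
      have k: "cring ?k" by (rule k.is_cring)
      obtain \<phi> where \<phi>: "\<phi> \<in> ring_hom ?W ?k" "\<And>r. r \<in> carrier R \<Longrightarrow> \<phi> (?\<kappa> r) = ?p r"
        "\<And>\<qq>. primeideal \<qq> ?k \<Longrightarrow> \<exists>f\<in>B. \<phi> f \<notin> \<qq>"
        using fibres[OF \<mm>] unfolding ex_in_conv[symmetric] W_points_iff[OF W k B(2,3)] by metis
      \<comment> \<open>The residue ring is a field: the point avoids its zero ideal, so some \<open>f\<close> has a unit value,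
        and this is also a value of \<open>F\<close>.\<close>
      obtain f where f: "f \<in> B" "\<phi> f \<noteq> \<zero>\<^bsub>?k\<^esub>" using \<phi>(3)[OF k.zeroprimeideal] by blast
      obtain s where s: "s \<in> {1..N} \<rightarrow> carrier ?W" "mpoly_eval R ?W ?\<kappa> s F = f"
        using value_at[OF f(1)] by blast
      have \<phi>s: "\<phi> \<circ> s \<in> {1..N} \<rightarrow> carrier ?k" 
        by (intro funcsetI) (simp only: o_apply ring_hom_closed[OF \<phi>(1) funcset_mem[OF s(1)]])
      have "\<phi> f = mpoly_eval R ?k (\<phi> \<circ> ?\<kappa>) (\<phi> \<circ> s) F"
        unfolding s(2)[symmetric]
        by (rule hom_mpoly_eval[OF _ _ F s(1)])
          (use R W k \<kappa> \<phi>(1) in \<open>auto intro!: ring_hom_cring.intro ring_hom_cring_axioms.intro\<close>)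
      also have "\<dots> = mpoly_eval R ?k ?p (\<phi> \<circ> s) F"
        by (rule mpoly_eval_cong[OF F k p \<phi>s, symmetric]) (simp_all add: \<phi>(2))
      finally have "mpoly_eval R ?k ?p (\<phi> \<circ> s) F = \<phi> f" ..
      moreover have "\<phi> f \<in> Units ?k"
        using f B(2) ring_hom_closed[OF \<phi>(1)] k.field_Units by blast
      ultimately show ?thesis using \<phi>s unfolding represents_unit_def by metis
    qed
    then have "represents_unit R R (\<lambda>r. r) {1..N} F" using assms(1) F unfolding LG_ring_def by blast
    then show ?thesis using point unfolding represents_unit_def by blast
  qed
  have b: "W_points R M U R (\<lambda>r. r) \<noteq> {}" if pc: "primitive_criterion R" and dense: "R_dense R M U"
  proof -
    have Fc: "range F \<subseteq> carrier R" using mpoly_carrierD(1)[OF F] by auto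
    have "Idl\<^bsub>R\<^esub> (range F) = carrier R"
    proof (rule ccontr)
      assume "Idl\<^bsub>R\<^esub> (range F) \<noteq> carrier R"
      then obtain \<mm> where \<mm>: "maximalideal \<mm> R" "Idl\<^bsub>R\<^esub> (range F) \<subseteq> \<mm>"
        using R.exists_maximalideal_containing[OF R.genideal_ideal[OF Fc]] by blast
      have F\<mm>: "F m \<in> \<mm>" for m using R.genideal_self[OF Fc] \<mm>(2) by blast
      have prime: "primeideal \<mm> R" by (rule R.maximalideal_prime[OF \<mm>(1)])
      interpret \<mm>: primeideal \<mm> R by (rule prime)
      let ?S = "topspace (W_fibre R M \<mm>)"
      have S: "?S = {\<qq>. primeideal \<qq> ?W \<and> {r \<in> carrier R. ?\<kappa> r \<in> \<qq>} = \<mm>}"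
        unfolding W_fibre_def by (auto simp: topspace_Spec)
      \<comment> \<open>The fibre is nonempty, as it contains the image of \<open>\<mm>\<close> under the zero section. Hence the
        dense open subset \<open>U\<close> meets it.\<close>
      define z where "z = mpoly_eval R R (\<lambda>r. r) (\<lambda>_. \<zero>\<^bsub>R\<^esub>) \<circ> \<tau>"
      have z: "z \<in> ring_hom ?W R" "\<And>r. r \<in> carrier R \<Longrightarrow> z (?\<kappa> r) = r"
        using section_hom[of "\<lambda>_. \<zero>\<^bsub>R\<^esub>"] by (auto simp: z_def)
      have "primeideal {a \<in> carrier ?W. z a \<in> \<mm>} ?W"
        using W R prime z(1) by (intro ring_hom_ring.primeideal_vimage ring_hom_ringI2) (auto simp: cring_def)
      moreover have "{r \<in> carrier R. ?\<kappa> r \<in> {a \<in> carrier ?W. z a \<in> \<mm>}} = \<mm>"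
        using z(2) ring_hom_closed[OF \<kappa>] \<mm>.a_subset by auto
      ultimately have "?S \<noteq> {}" unfolding S by blast
      moreover have "W_fibre R M \<mm> closure_of (U \<inter> ?S) = ?S"
        using dense prime unfolding R_dense_def by (simp add: topspace_Spec)
      ultimately have "U \<inter> ?S \<noteq> {}" by (metis closure_of_empty)
      then obtain \<qq> f where \<qq>: "primeideal \<qq> ?W" "{r \<in> carrier R. ?\<kappa> r \<in> \<qq>} = \<mm>"
        and f: "f \<in> B" "f \<notin> \<qq>" unfolding S B(3) by blast
      obtain s where s: "s \<in> {1..N} \<rightarrow> carrier ?W" "mpoly_eval R ?W ?\<kappa> s F = f"
        using value_at[OF f(1)] by blast
      \<comment> \<open>The coefficients of \<open>F\<close> map into \<open>\<qq>\<close>, hence so does every value of \<open>F\<close> over the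
        coordinate ring of \<open>W(M)\<close>. One of these values is \<open>f\<close>.\<close>
      have I: "ideal \<qq> ?W" using \<qq>(1) by (rule primeideal.axioms)
      have "monomial_value ?W s m \<in> carrier ?W" if "F m \<noteq> \<zero>\<^bsub>R\<^esub>" for m
        using s(1) mpoly_carrierD(3)[OF F that] by (intro cring.monomial_value_closed[OF W]) auto
      moreover have "?\<kappa> (F m) \<in> \<qq>" for m using F\<mm>[of m] \<qq>(2) by blast
      ultimately have "mpoly_eval R ?W ?\<kappa> s F \<in> \<qq>"
        unfolding mpoly_eval_alt by (intro ideal_finsum_mem[OF I] ideal.I_r_closed[OF I]) auto
      then show False using s(2) f(2) by simp
    qed
    then show ?thesis using primitive_criterion_multivariate[OF R pc F] point by metis
  qed
  show ?thesis using a1 a2 b by blast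
qed

end
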